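(* Let $D=(0,1)$, $\alpha\in(3/2,2)$, $V=H^1_0(D)$, $f,q,p\in H^1(D)$, and let $A(\psi,\varphi)=(\psi',\varphi')+({}_0^RD_x^{2-\alpha}\psi,q\varphi)+({}_0^RD_x^{2-\alpha}\psi)(1)(p,\varphi)$ satisfy: $A(w,v)=0\ \forall v\in V\Rightarrow w=0$, and $A(w,v)=0\ \forall w\in V\Rightarrow v=0$. Let $w\in V$ solve $A(w,\varphi)=(f,\varphi)$ for all $\varphi\in V$. For $k\in\{0,1\}$ let $V_h$ be the finite element space of continuous piecewise polynomials of degree at most $k+1$ defined below, and let $w_h\in V_h$ solve $A(w_h,v_h)=(f,v_h)$ for all $v_h\in V_h$. Then there is $h_0>0$ such that for all $h\le h_0$ and every $\beta\in(2-\alpha,1/2)$, $$\|w-w_h\|_{L^2(D)}+h^{\alpha-2+\beta}\|(w-w_h)'\|_{L^2(D)}\le Ch^{\alpha+k-1+\beta}\|f\|_{H^1(D)},$$ with $C$ independent of $h$ and $f$.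
   Context: $(\cdot,\cdot)$ is the $L^2(D)$ inner product. For $w\in H^1_0(D)$, ${}_0^RD_x^{2-\alpha}w(x)=\frac{1}{\Gamma(\alpha-1)}\int_0^x(x-t)^{\alpha-2}w'(t)dt$ and $({}_0^RD_x^{2-\alpha}w)(1)=\frac{1}{\Gamma(\alpha-1)}\int_0^1(1-t)^{\alpha-2}w'(t)dt$. $V_h$: for a quasi-uniform partition of $D$ with maximal subinterval length $h$, the space of continuous piecewise polynomials of degree at most $k+1$ vanishing at $0$ and $1$. *)

theory Defs
  imports "HOL-Analysis.Analysis" "HOL-Computational_Algebra.Polynomial"
begin

text \<open>D = (0,1). An H^1(D) function is represented by its continuous representative u
  on [0,1] together with an L^2 weak derivative g: u x = u 0 + int_0^x g.\<close>

definition H1_rep :: "(real \<Rightarrow> real) \<Rightarrow> (real \<Rightarrow> real) \<Rightarrow> bool" where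
  "H1_rep u g \<longleftrightarrow> set_integrable lborel {0..1} g
     \<and> set_integrable lborel {0..1} (\<lambda>t. (g t)^2)
     \<and> (\<forall>x\<in>{0..1}. u x = u 0 + (LINT t:{0..x}|lborel. g t))"

definition H1 :: "(real \<Rightarrow> real) set" where
  "H1 = {u. \<exists>g. H1_rep u g}"

definition H10 :: "(real \<Rightarrow> real) set" where
  "H10 = {u \<in> H1. u 0 = 0 \<and> u 1 = 0}"

text \<open>Weak derivative (unique up to null sets).\<close>
definition wd :: "(real \<Rightarrow> real) \<Rightarrow> real \<Rightarrow> real" where
  "wd u = (SOME g. H1_rep u g)"

definition L2ip :: "(real \<Rightarrow> real) \<Rightarrow> (real \<Rightarrow> real) \<Rightarrow> real" where
  "L2ip u v = (LINT x:{0..1}|lborel. u x * v x)"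

definition L2norm :: "(real \<Rightarrow> real) \<Rightarrow> real" where
  "L2norm u = sqrt (L2ip u u)"

definition H1norm :: "(real \<Rightarrow> real) \<Rightarrow> real" where
  "H1norm u = sqrt (L2ip u u + L2ip (wd u) (wd u))"

text \<open>Riemann-Liouville derivative of order 2-alpha of w in H^1_0.\<close>
definition RL :: "real \<Rightarrow> (real \<Rightarrow> real) \<Rightarrow> real \<Rightarrow> real" where
  "RL \<alpha> w x = (1 / Gamma (\<alpha> - 1)) * (LINT t:{0..x}|lborel. (x - t) powr (\<alpha> - 2) * wd w t)"

definition Aform :: "real \<Rightarrow> (real \<Rightarrow> real) \<Rightarrow> (real \<Rightarrow> real) \<Rightarrow> (real \<Rightarrow> real) \<Rightarrow> (real \<Rightarrow> real) \<Rightarrow> real" where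
  "Aform \<alpha> q p \<psi> \<phi> = L2ip (wd \<psi>) (wd \<phi>) + L2ip (RL \<alpha> \<psi>) (\<lambda>x. q x * \<phi> x)
      + RL \<alpha> \<psi> 1 * L2ip p \<phi>"

definition is_partition :: "nat \<Rightarrow> (nat \<Rightarrow> real) \<Rightarrow> bool" where
  "is_partition n x \<longleftrightarrow> n \<ge> 1 \<and> x 0 = 0 \<and> x n = 1 \<and> (\<forall>i<n. x i < x (Suc i))"

definition mesh :: "nat \<Rightarrow> (nat \<Rightarrow> real) \<Rightarrow> real" where
  "mesh n x = Max ((\<lambda>i. x (Suc i) - x i) ` {..<n})"

definition quasi_uniform :: "real \<Rightarrow> nat \<Rightarrow> (nat \<Rightarrow> real) \<Rightarrow> bool" where
  "quasi_uniform \<rho> n x \<longleftrightarrow> (\<forall>i<n. x (Suc i) - x i \<ge> \<rho> * mesh n x)"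

definition FE_space :: "nat \<Rightarrow> nat \<Rightarrow> (nat \<Rightarrow> real) \<Rightarrow> (real \<Rightarrow> real) set" where
  "FE_space k n x = {v. continuous_on {0..1} v \<and> v 0 = 0 \<and> v 1 = 0 \<and>
     (\<forall>i<n. \<exists>P :: real poly. degree P \<le> k + 1 \<and> (\<forall>y\<in>{x i..x (Suc i)}. v y = poly P y))}"

end

theory Submission
  imports Defs "HOL-Complex_Analysis.Great_Picard"
begin

text \<open>
  Write \<open>A(\<psi>, \<phi>) = (\<psi>' - T \<psi>', \<phi>')\<close>, where \<open>T\<close> integrates the lower order terms once and is therefore
  smoothing. Uniqueness and compactness bound a continuous mean-zero \<open>u\<close> by \<open>u - T u\<close>, which also yields
  the regularity of \<open>w\<close>: its derivative is Lipschitz, and for the quadratic elements it has a derivative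
  whose increments are controlled by the integral of a square integrable function.

  The error estimate avoids the adjoint problem. For \<open>d = (w - wh)'\<close> the function \<open>r = d - T d\<close> is
  orthogonal to all piecewise polynomials of degree at most \<open>k\<close>, so its norm is bounded by the best
  approximation error of \<open>w' - T d\<close>. The fractional integral of \<open>r\<close> pairs \<open>r\<close> with a kernel that piecewise
  constants approximate to the order \<open>h powr (\<alpha> - 3/2)\<close>; hence \<open>T r\<close>, by stability also \<open>T d\<close>, and finally
  \<open>w - wh\<close>, the primitive of \<open>r + T d\<close>, gain this factor over \<open>r\<close>. Since \<open>\<beta> < 1/2\<close>, it is at most
  \<open>h powr (\<alpha> - 2 + \<beta>)\<close>.
\<close>

section \<open>Square integrable functions on the unit interval\<close>

text \<open>The condition \<alpha> > 3/2 is what makes the kernel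
  \<open>(x - t) powr (\<alpha> - 2)\<close> square integrable: Cauchy-Schwarz alone then maps
  square integrable functions to bounded ones, and \<alpha> - 3/2 is the order of the norm of the
  kernel over a piece of length \<open>h\<close> at its singularity. Two obstacles shape the
  argument. Compactness gives stability in the maximum norm for continuous functions, whereas
  \<open>d\<close> is only a class of square integrable functions; stability is therefore used for
  \<open>T d\<close>, which is Lipschitz. And bounding \<open>r\<close> through
  \<open>w' - T d\<close> is circular, because \<open>T d\<close> depends on the error; a Lipschitz
  function is approximated with a factor \<open>h\<close>, and \<open>h0\<close> is chosen so that
  this contribution is absorbed. The third derivative of \<open>w\<close> is never constructed.
  Domination of the increments of the second one by integrals is all that quadratic elements
  use.\<close>

definition UI :: "real measure" where
  "UI = restrict_space lborel {0..1}"

lemma space_UI [simp]: "space UI = {0..1}"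
  by (simp add: UI_def)

lemma sets_UI: "sets UI = sets (restrict_space borel {0..1})"
  unfolding UI_def by (rule sets_restrict_space_cong) simp

lemma ident_measurable_UI [measurable]: "(\<lambda>x. x) \<in> borel_measurable UI"
  unfolding UI_def by (rule measurable_restrict_space1) simp

lemma finite_measure_UI: "finite_measure UI"
  by (rule finite_measureI) (simp add: UI_def emeasure_restrict_space)

interpretation UI: finite_measure UI
  by (rule finite_measure_UI)

lemma measure_UI [simp]: "measure UI {0..1} = 1"
  by (simp add: UI_def measure_restrict_space)

lemma integral_UI: "integral\<^sup>L UI f = (LINT x:{0..1}|lborel. f x)" for f :: "real \<Rightarrow> real"
  by (simp add: UI_def integral_restrict_space set_lebesgue_integral_def)

lemma integrable_UI: "integrable UI f \<longleftrightarrow> set_integrable lborel {0..1} f" for f :: "real \<Rightarrow> real"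
  by (simp add: UI_def integrable_restrict_space set_integrable_def)

lemma measurable_UI_iff:
  "f \<in> borel_measurable UI \<longleftrightarrow> (\<lambda>x. indicator {0..1} x * f x) \<in> borel_measurable borel"
  for f :: "real \<Rightarrow> real"
  by (simp add: UI_def borel_measurable_restrict_space_iff)

lemma measurable_UI_borel: "f \<in> borel_measurable borel \<Longrightarrow> f \<in> borel_measurable UI"
  for f :: "real \<Rightarrow> real"
  unfolding UI_def by (rule measurable_restrict_space1) simp

lemma measurable_UI_continuous: "continuous_on {0..1} f \<Longrightarrow> f \<in> borel_measurable UI"
  for f :: "real \<Rightarrow> real"
  unfolding measurable_cong_sets[OF sets_UI refl]
  by (rule borel_measurable_continuous_on_restrict)

lemma indicator_measurable_UI [measurable]: "(indicator {a..b} :: real \<Rightarrow> real) \<in> borel_measurable UI"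
  by (rule measurable_UI_borel) simp

text \<open>Functions rather than classes, so equalities almost everywhere are carried explicitly.
  Values outside the unit interval do not matter.\<close>

definition L2 :: "(real \<Rightarrow> real) set" where
  "L2 = {g. g \<in> borel_measurable UI \<and> integrable UI (\<lambda>x. (g x)\<^sup>2)}"

lemma L2_measurable: "g \<in> L2 \<Longrightarrow> g \<in> borel_measurable UI"
  by (simp add: L2_def)

lemma L2_integrable_mult:
  assumes "f \<in> L2" "g \<in> L2"
  shows "integrable UI (\<lambda>x. f x * g x)"
proof (rule Bochner_Integration.integrable_bound)
  show "integrable UI (\<lambda>x. (f x)\<^sup>2 + (g x)\<^sup>2)"
    using assms by (auto simp: L2_def)
  show "(\<lambda>x. f x * g x) \<in> borel_measurable UI"
    using assms by (auto simp: L2_def)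
  have "\<bar>a * b\<bar> \<le> a\<^sup>2 + b\<^sup>2" for a b :: real
    using sum_squares_bound[of "\<bar>a\<bar>" "\<bar>b\<bar>"] mult_nonneg_nonneg[of "\<bar>a\<bar>" "\<bar>b\<bar>"]
    unfolding abs_mult power2_abs by linarith
  then show "AE x in UI. norm (f x * g x) \<le> norm ((f x)\<^sup>2 + (g x)\<^sup>2)"
    by (simp add: abs_of_nonneg)
qed

lemma L2_bounded:
  assumes "g \<in> borel_measurable UI" "\<And>x. x \<in> {0..1} \<Longrightarrow> \<bar>g x\<bar> \<le> B"
  shows "g \<in> L2"
proof -
  have "integrable UI (\<lambda>x. (g x)\<^sup>2)"
  proof (rule UI.integrable_const_bound)
    show "AE x in UI. norm ((g x)\<^sup>2) \<le> B\<^sup>2"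
      using assms(2) by (auto intro!: AE_I2 simp: abs_le_square_iff[symmetric] power_abs)
         (smt (verit) abs_le_square_iff assms(2) atLeastAtMost_iff)
  qed (use assms in measurable)
  with assms show ?thesis by (simp add: L2_def)
qed

lemma L2_continuous:
  assumes "continuous_on {0..1} g"
  shows "g \<in> L2"
proof -
  have "compact (g ` {0..1})"
    using assms by (rule compact_continuous_image) simp
  then obtain B where "\<And>x. x \<in> {0..1} \<Longrightarrow> \<bar>g x\<bar> \<le> B"
    by (force dest!: compact_imp_bounded simp: bounded_iff)
  then show ?thesis
    by (rule L2_bounded[OF measurable_UI_continuous[OF assms]])
qed

lemma L2_const [simp, intro]: "(\<lambda>x. c) \<in> L2"
  by (rule L2_continuous) simp

lemma L2_indicator [simp, intro]: "(indicator {a..b} :: real \<Rightarrow> real) \<in> L2"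
  by (rule L2_bounded[where B=1]) (auto simp: indicator_def)

lemma L2_add [intro]:
  assumes "f \<in> L2" "g \<in> L2" shows "(\<lambda>x. f x + g x) \<in> L2"
proof -
  have "integrable UI (\<lambda>x. (f x)\<^sup>2 + 2 * (f x * g x) + (g x)\<^sup>2)"
    using assms L2_integrable_mult[OF assms] by (auto simp: L2_def)
  then show ?thesis
    using assms by (auto simp: L2_def power2_sum algebra_simps)
qed

lemma L2_cmult [intro]: "f \<in> L2 \<Longrightarrow> (\<lambda>x. c * f x) \<in> L2"
  by (auto simp: L2_def power_mult_distrib)

lemma L2_minus [intro]: "f \<in> L2 \<Longrightarrow> (\<lambda>x. - f x) \<in> L2"
  by (auto simp: L2_def)

lemma L2_diff [intro]: "f \<in> L2 \<Longrightarrow> g \<in> L2 \<Longrightarrow> (\<lambda>x. f x - g x) \<in> L2"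
  using L2_add[OF _ L2_minus] by fastforce

lemma L2_abs [intro]: "f \<in> L2 \<Longrightarrow> (\<lambda>x. \<bar>f x\<bar>) \<in> L2"
  by (auto simp: L2_def)

lemma L2_dominated:
  assumes "g \<in> L2" "f \<in> borel_measurable UI" "\<And>x. x \<in> {0..1} \<Longrightarrow> \<bar>f x\<bar> \<le> \<bar>g x\<bar>"
  shows "f \<in> L2"
proof -
  have "integrable UI (\<lambda>x. (f x)\<^sup>2)"
    by (rule Bochner_Integration.integrable_bound[of _ "\<lambda>x. (g x)\<^sup>2"])
       (use assms in \<open>auto simp: L2_def abs_le_square_iff[symmetric] intro!: AE_I2\<close>)
  with assms show ?thesis by (simp add: L2_def)
qed

lemma L2_mult_bounded:
  assumes "g \<in> L2" "f \<in> borel_measurable UI" "\<And>x. x \<in> {0..1} \<Longrightarrow> \<bar>f x\<bar> \<le> B"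
  shows "(\<lambda>x. f x * g x) \<in> L2"
proof (rule L2_dominated)
  show "(\<lambda>x. B * g x) \<in> L2" using assms(1) by (rule L2_cmult)
  show "(\<lambda>x. f x * g x) \<in> borel_measurable UI" using assms by (auto simp: L2_def)
  show "\<bar>f x * g x\<bar> \<le> \<bar>B * g x\<bar>" if "x \<in> {0..1}" for x
    using assms(3)[OF that] by (simp add: abs_mult mult_right_mono)
qed

lemma L2_indicator_mult: "g \<in> L2 \<Longrightarrow> (\<lambda>x. indicator {a..b} x * g x) \<in> L2"
  by (rule L2_mult_bounded[where B=1]) (auto simp: indicator_def)

lemma L2_integrable: "f \<in> L2 \<Longrightarrow> integrable UI f"
  using L2_integrable_mult[of "\<lambda>x. 1" f] by simp

lemma L2_cong: "f \<in> L2 \<Longrightarrow> (\<And>x. x \<in> {0..1} \<Longrightarrow> f x = g x) \<Longrightarrow> g \<in> L2"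
  unfolding L2_def
  by (auto cong: measurable_cong integrable_cong
      intro: measurable_cong[THEN iffD1, rotated] Bochner_Integration.integrable_cong[THEN iffD1, rotated 2])

lemma L2_sum:
  assumes "finite I" "\<And>i. i \<in> I \<Longrightarrow> f i \<in> L2"
  shows "(\<lambda>x. \<Sum>i\<in>I. f i x) \<in> L2"
  using assms by (induction rule: finite_induct) (auto intro!: L2_add)

lemma L2ip_UI: "L2ip u v = (\<integral>x. u x * v x \<partial>UI)"
  by (simp add: L2ip_def integral_UI)

lemma L2ip_commute: "L2ip u v = L2ip v u"
  by (simp add: L2ip_def mult.commute)

lemma L2ip_add_left: "f \<in> L2 \<Longrightarrow> g \<in> L2 \<Longrightarrow> h \<in> L2 \<Longrightarrow> L2ip (\<lambda>x. f x + g x) h = L2ip f h + L2ip g h"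
  by (simp add: L2ip_UI ring_distribs L2_integrable_mult)

lemma L2ip_diff_left: "f \<in> L2 \<Longrightarrow> g \<in> L2 \<Longrightarrow> h \<in> L2 \<Longrightarrow> L2ip (\<lambda>x. f x - g x) h = L2ip f h - L2ip g h"
  by (simp add: L2ip_UI left_diff_distrib L2_integrable_mult)

lemma L2ip_add_right: "f \<in> L2 \<Longrightarrow> g \<in> L2 \<Longrightarrow> h \<in> L2 \<Longrightarrow> L2ip h (\<lambda>x. f x + g x) = L2ip h f + L2ip h g"
  by (simp add: L2ip_UI ring_distribs L2_integrable_mult)

lemma L2ip_diff_right: "f \<in> L2 \<Longrightarrow> g \<in> L2 \<Longrightarrow> h \<in> L2 \<Longrightarrow> L2ip h (\<lambda>x. f x - g x) = L2ip h f - L2ip h g"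
  by (simp add: L2ip_UI right_diff_distrib L2_integrable_mult)

lemma L2ip_cmult_left: "L2ip (\<lambda>x. c * f x) h = c * L2ip f h"
  by (simp add: L2ip_UI mult.assoc)

lemma L2ip_cmult_right: "L2ip h (\<lambda>x. c * f x) = c * L2ip h f"
  by (simp add: L2ip_UI mult.left_commute)

lemma L2ip_one: "L2ip (\<lambda>x. 1) f = integral\<^sup>L UI f"
  by (simp add: L2ip_UI)

lemma L2ip_cong:
  assumes "\<And>x. x \<in> {0..1} \<Longrightarrow> f x = f' x" "\<And>x. x \<in> {0..1} \<Longrightarrow> g x = g' x"
  shows "L2ip f g = L2ip f' g'"
  unfolding L2ip_UI by (rule Bochner_Integration.integral_cong) (use assms in auto)

lemma L2ip_cong_AE:
  assumes "f \<in> L2" "g \<in> L2" "h \<in> L2" "AE x in UI. f x = g x"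
  shows "L2ip f h = L2ip g h"
  unfolding L2ip_UI
  by (rule integral_cong_AE) (use assms in \<open>auto simp: L2_def\<close>)

lemma L2ip_abs_le:
  assumes "f \<in> L2" "g \<in> L2" "h \<in> L2"
    and "\<And>x. x \<in> {0..1} \<Longrightarrow> 0 \<le> f x" "\<And>x. x \<in> {0..1} \<Longrightarrow> \<bar>g x\<bar> \<le> h x"
  shows "\<bar>L2ip f g\<bar> \<le> L2ip f h"
proof -
  have "\<bar>L2ip f g\<bar> \<le> (\<integral>x. \<bar>f x * g x\<bar> \<partial>UI)"
    unfolding L2ip_UI by (rule integral_abs_bound)
  also have "\<dots> \<le> L2ip f h"
    unfolding L2ip_UI
  proof (rule Bochner_Integration.integral_mono)
    show "integrable UI (\<lambda>x. \<bar>f x * g x\<bar>)" using L2_integrable_mult[OF assms(1,2)] by auto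
    show "integrable UI (\<lambda>x. f x * h x)" by (rule L2_integrable_mult[OF assms(1,3)])
    show "\<bar>f x * g x\<bar> \<le> f x * h x" if "x \<in> space UI" for x
      using assms(4,5)[of x] that by (simp add: abs_mult mult_left_mono)
  qed
  finally show ?thesis .
qed

lemma L2ip_self_nonneg: "0 \<le> L2ip f f"
  by (auto simp: L2ip_UI intro!: Bochner_Integration.integral_nonneg)

lemma L2norm_nonneg [simp]: "0 \<le> L2norm f"
  by (simp add: L2norm_def L2ip_self_nonneg)

lemma L2norm_square: "(L2norm f)\<^sup>2 = L2ip f f"
  by (simp add: L2norm_def L2ip_self_nonneg)

lemma L2norm_cong: "(\<And>x. x \<in> {0..1} \<Longrightarrow> f x = g x) \<Longrightarrow> L2norm f = L2norm g"
  unfolding L2norm_def by (subst L2ip_cong[of f g f g]) auto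

lemma L2norm_cmult: "L2norm (\<lambda>x. c * f x) = \<bar>c\<bar> * L2norm f"
  by (simp add: L2norm_def L2ip_cmult_left L2ip_cmult_right real_sqrt_mult mult.assoc[symmetric])

lemma L2_Cauchy_Schwarz:
  assumes "f \<in> L2" "g \<in> L2"
  shows "\<bar>L2ip f g\<bar> \<le> L2norm f * L2norm g"
proof -
  define a b c where "a = L2ip f f" "b = L2ip f g" "c = L2ip g g"
  have nn: "0 \<le> a" "0 \<le> c"
    by (auto simp: a_b_c_def L2ip_self_nonneg)
  have *: "0 \<le> a - 2 * t * b + t\<^sup>2 * c" for t
  proof -
    have m: "(\<lambda>x. t * g x) \<in> L2" "(\<lambda>x. f x - t * g x) \<in> L2" using assms by auto
    have "0 \<le> L2ip (\<lambda>x. f x - t * g x) (\<lambda>x. f x - t * g x)" by (rule L2ip_self_nonneg)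
    also have "\<dots> = a - 2 * t * b + t\<^sup>2 * c"
      using assms m
      by (simp add: L2ip_diff_left L2ip_diff_right L2ip_cmult_left L2ip_cmult_right a_b_c_def
          L2ip_commute[of g f] power2_eq_square algebra_simps)
    finally show ?thesis .
  qed
  have "b\<^sup>2 \<le> a * c"
  proof (cases "c = 0")
    case True
    have "b = 0"
    proof (rule ccontr)
      assume "b \<noteq> 0"
      \<comment> \<open>For \<open>c = 0\<close> the quadratic is affine in \<open>t\<close>; at
        this \<open>t\<close> it equals -1.\<close>
      with *[of "(a + 1) / (2 * b)"] True nn show False by simp
    qed
    then show ?thesis using nn by simp
  next
    case False
    then have "c > 0" using nn by simp
    with *[of "b / c"] have "0 \<le> c * (a - 2 * (b / c) * b + (b / c)\<^sup>2 * c)" by simp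
    also have "\<dots> = a * c - b\<^sup>2" using False by (simp add: power2_eq_square field_simps)
    finally show ?thesis by simp
  qed
  then have "sqrt (b\<^sup>2) \<le> sqrt (a * c)" by (rule real_sqrt_le_mono)
  then show ?thesis by (simp add: a_b_c_def L2norm_def real_sqrt_mult)
qed

lemma L2norm_triangle:
  assumes "f \<in> L2" "g \<in> L2"
  shows "L2norm (\<lambda>x. f x + g x) \<le> L2norm f + L2norm g"
proof (rule power2_le_imp_le)
  have "(L2norm (\<lambda>x. f x + g x))\<^sup>2 = L2ip f f + 2 * L2ip f g + L2ip g g"
    using assms by (simp add: L2norm_square L2ip_add_left L2ip_add_right L2_add L2ip_commute[of g f])
  also have "\<dots> \<le> L2ip f f + 2 * (L2norm f * L2norm g) + L2ip g g"
    using L2_Cauchy_Schwarz[OF assms] by linarith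
  also have "\<dots> = (L2norm f + L2norm g)\<^sup>2"
    by (simp add: L2norm_square power2_sum)
  finally show "(L2norm (\<lambda>x. f x + g x))\<^sup>2 \<le> (L2norm f + L2norm g)\<^sup>2" .
qed simp

lemma L2norm_triangle_diff:
  assumes "f \<in> L2" "g \<in> L2"
  shows "L2norm (\<lambda>x. f x - g x) \<le> L2norm f + L2norm g"
  using L2norm_triangle[OF assms(1) L2_minus[OF assms(2)]] L2norm_cmult[of "-1" g] by simp

lemma L2norm_mono:
  assumes "g \<in> L2" "f \<in> borel_measurable UI" "\<And>x. x \<in> {0..1} \<Longrightarrow> \<bar>f x\<bar> \<le> \<bar>g x\<bar>"
  shows "L2norm f \<le> L2norm g"
  unfolding L2norm_def L2ip_UI
proof (intro real_sqrt_le_mono Bochner_Integration.integral_mono)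
  have "f \<in> L2" using assms by (rule L2_dominated)
  then show "integrable UI (\<lambda>x. f x * f x)" by (simp add: L2_integrable_mult)
  show "integrable UI (\<lambda>x. g x * g x)" using assms by (simp add: L2_integrable_mult)
  show "f x * f x \<le> g x * g x" if "x \<in> space UI" for x
    using assms(3)[of x] that by (simp add: abs_le_square_iff power2_eq_square)
qed

lemma L2norm_const: "L2norm (\<lambda>x. c) = \<bar>c\<bar>"
  by (simp add: L2norm_def L2ip_UI)

lemma L2norm_bounded:
  assumes "f \<in> borel_measurable UI" "\<And>x. x \<in> {0..1} \<Longrightarrow> \<bar>f x\<bar> \<le> B"
  shows "L2norm f \<le> B"
proof -
  have "L2norm f \<le> L2norm (\<lambda>x. B)"
    by (rule L2norm_mono) (use assms in fastforce)+
  moreover have "0 \<le> B" using assms(2)[of 0] by simp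
  ultimately show ?thesis by (simp add: L2norm_const)
qed

lemma L2norm_indicator:
  assumes "0 \<le> a" "a \<le> b" "b \<le> 1"
  shows "L2norm (indicator {a..b}) = sqrt (b - a)"
proof -
  have "L2ip (indicator {a..b}) (indicator {a..b}) = (\<integral>x. indicator {a..b} x \<partial>UI)"
    unfolding L2ip_UI by (rule Bochner_Integration.integral_cong) (auto simp: indicator_def)
  also have "\<dots> = measure UI {a..b}"
    using assms by (simp add: Int_absorb2)
  also have "\<dots> = b - a"
    using assms by (simp add: UI_def measure_restrict_space)
  finally show ?thesis by (simp add: L2norm_def)
qed

lemma L2ip_zero_imp_AE:
  assumes "g \<in> L2" "L2ip g g = 0"
  shows "AE x in UI. g x = 0"
proof -
  have "AE x in UI. (g x)\<^sup>2 = 0"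
    using assms by (subst integral_nonneg_eq_0_iff_AE[symmetric]) (auto simp: L2_def L2ip_UI power2_eq_square)
  then show ?thesis by simp
qed

section \<open>Primitives and weak derivatives\<close>

text \<open>As an inner product with an indicator, the primitive inherits linearity and
  Cauchy-Schwarz from \<open>L2ip\<close>.\<close>

definition prim :: "(real \<Rightarrow> real) \<Rightarrow> real \<Rightarrow> real" where
  "prim g x = L2ip (indicator {0..x}) g"

lemma prim_eq_integral:
  assumes "x \<in> {0..1}"
  shows "(LINT t:{0..x}|lborel. g t) = prim g x"
  unfolding prim_def L2ip_def set_lebesgue_integral_def
  by (rule Bochner_Integration.integral_cong) (use assms in \<open>auto simp: indicator_def\<close>)

lemma H1_rep_iff: "H1_rep u g \<longleftrightarrow> g \<in> L2 \<and> (\<forall>x\<in>{0..1}. u x = u 0 + prim g x)"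
proof -
  have "set_integrable lborel {0..1} g \<and> set_integrable lborel {0..1} (\<lambda>t. (g t)\<^sup>2) \<longleftrightarrow> g \<in> L2"
    unfolding integrable_UI[symmetric] using L2_integrable[of g]
    by (fastforce simp: L2_def dest: borel_measurable_integrable)
  moreover have "(\<forall>x\<in>{0..1}. u x = u 0 + (LINT t:{0..x}|lborel. g t)) \<longleftrightarrow>
      (\<forall>x\<in>{0..1}. u x = u 0 + prim g x)"
    by (rule ball_cong) (simp_all only: prim_eq_integral)
  ultimately show ?thesis
    unfolding H1_rep_def by blast
qed

lemma AE_UI_neq: "AE t in UI. t \<noteq> (x::real)"
  unfolding UI_def by (subst AE_restrict_space_iff) (use AE_lborel_singleton[of x] in auto)

lemma prim_0: "prim g 0 = 0"
proof -
  have "(\<integral>t. indicator {0..0} t * g t \<partial>UI) = 0"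
    by (rule integral_eq_zero_AE) (use AE_UI_neq[of 0] in \<open>auto elim!: eventually_mono\<close>)
  then show ?thesis by (simp add: prim_def L2ip_UI)
qed

lemma prim_1: "prim g 1 = integral\<^sup>L UI g"
  unfolding prim_def L2ip_UI by (rule Bochner_Integration.integral_cong) (auto simp: indicator_def)

lemma prim_1_L2ip: "prim g 1 = L2ip (\<lambda>x. 1) g"
  by (simp add: prim_1 L2ip_one)

lemma prim_diff_eq:
  assumes "g \<in> L2" "0 \<le> x" "x \<le> y"
  shows "prim g y - prim g x = L2ip (indicator {x..y}) g"
proof -
  have "prim g y = L2ip (\<lambda>t. indicator {0..x} t + indicator {x..y} t) g"
    unfolding prim_def
  proof (rule L2ip_cong_AE)
    show "AE t in UI. indicator {0..y} t = (indicator {0..x} t + indicator {x..y} t :: real)"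
      using AE_UI_neq[of x] by eventually_elim (use assms in \<open>auto simp: indicator_def\<close>)
  qed (use assms in auto)
  also have "\<dots> = prim g x + L2ip (indicator {x..y}) g"
    unfolding prim_def using assms by (intro L2ip_add_left) auto
  finally show ?thesis by simp
qed

lemma prim_diff_abs:
  assumes "g \<in> L2" "0 \<le> z" "z \<le> y"
  shows "\<bar>prim g y - prim g z\<bar> \<le> L2ip (indicator {z..y}) (\<lambda>x. \<bar>g x\<bar>)"
  unfolding prim_diff_eq[OF assms]
  by (rule L2ip_abs_le[OF L2_indicator assms(1) L2_abs[OF assms(1)]]) auto

text \<open>Cauchy-Schwarz against an indicator of norm \<open>sqrt \<bar>x - y\<bar>\<close>; on a
  mesh cell this gives a factor \<open>sqrt h\<close>.\<close>

lemma prim_diff_sqrt: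
  assumes "g \<in> L2" "x \<in> {0..1}" "y \<in> {0..1}"
  shows "\<bar>prim g x - prim g y\<bar> \<le> sqrt \<bar>x - y\<bar> * L2norm g"
proof -
  have *: "\<bar>prim g y - prim g x\<bar> \<le> sqrt (y - x) * L2norm g"
    if "x \<le> y" "x \<in> {0..1}" "y \<in> {0..1}" for x y
    using L2_Cauchy_Schwarz[OF L2_indicator assms(1), of x y] that
    by (simp add: prim_diff_eq[OF assms(1)] L2norm_indicator)
  show ?thesis
    using *[of x y] *[of y x] assms(2,3) by (cases "x \<le> y") (auto simp: abs_minus_commute)
qed

lemma prim_diff_bound:
  assumes "g \<in> L2" "x \<in> {0..1}" "y \<in> {0..1}" "\<And>t. t \<in> {0..1} \<Longrightarrow> \<bar>g t\<bar> \<le> B"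
  shows "\<bar>prim g x - prim g y\<bar> \<le> B * \<bar>x - y\<bar>"
proof -
  have *: "\<bar>prim g y - prim g x\<bar> \<le> B * (y - x)"
    if "x \<le> y" "x \<in> {0..1}" "y \<in> {0..1}" for x y
  proof -
    have i: "integrable UI (\<lambda>t. indicator {x..y} t * g t)"
      using assms(1) by (intro L2_integrable_mult) auto
    have "\<bar>\<integral>t. indicator {x..y} t * g t \<partial>UI\<bar> \<le> (\<integral>t. \<bar>indicator {x..y} t * g t\<bar> \<partial>UI)"
      by (rule integral_abs_bound)
    also have "\<dots> \<le> (\<integral>t. B * indicator {x..y} t \<partial>UI)"
    proof (rule Bochner_Integration.integral_mono)
      show "integrable UI (\<lambda>t. \<bar>indicator {x..y} t * g t\<bar>)" using i by auto
      show "integrable UI (\<lambda>t. B * indicator {x..y} t)" by (intro L2_integrable L2_cmult) auto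
      show "\<bar>indicator {x..y} t * g t\<bar> \<le> B * indicator {x..y} t" if "t \<in> space UI" for t
        using assms(4)[of t] that by (auto simp: indicator_def)
    qed
    also have "\<dots> = B * (y - x)"
      using that by (simp add: Int_absorb2 UI_def measure_restrict_space)
    finally show ?thesis
      by (simp add: prim_diff_eq[OF assms(1)] that L2ip_UI that(2)[simplified])
  qed
  show ?thesis
    using *[of x y] *[of y x] assms(2,3) by (cases "x \<le> y") (auto simp: abs_minus_commute)
qed

lemma prim_continuous:
  assumes "g \<in> L2"
  shows "continuous_on {0..1} (prim g)"
  unfolding continuous_on_def
proof
  fix x :: real assume x: "x \<in> {0..1}"
  have "((\<lambda>y. sqrt \<bar>y - x\<bar> * L2norm g) \<longlongrightarrow> sqrt \<bar>x - x\<bar> * L2norm g) (at x within {0..1})"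
    by (intro tendsto_intros)
  then have "((\<lambda>y. sqrt \<bar>y - x\<bar> * L2norm g) \<longlongrightarrow> 0) (at x within {0..1})"
    by simp
  then have "((\<lambda>y. prim g y - prim g x) \<longlongrightarrow> 0) (at x within {0..1})"
    by (rule Lim_null_comparison[rotated])
       (use x assms prim_diff_sqrt in \<open>auto simp: eventually_at_filter\<close>)
  then show "(prim g \<longlongrightarrow> prim g x) (at x within {0..1})"
    by (rule LIM_zero_cancel)
qed

lemma prim_L2 [intro]: "g \<in> L2 \<Longrightarrow> prim g \<in> L2"
  by (rule L2_continuous[OF prim_continuous])

lemma prim_add: "f \<in> L2 \<Longrightarrow> g \<in> L2 \<Longrightarrow> prim (\<lambda>x. f x + g x) x = prim f x + prim g x"
  by (simp add: prim_def L2ip_add_right)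

lemma prim_diff: "f \<in> L2 \<Longrightarrow> g \<in> L2 \<Longrightarrow> prim (\<lambda>x. f x - g x) x = prim f x - prim g x"
  by (simp add: prim_def L2ip_diff_right)

lemma prim_cmult: "prim (\<lambda>x. c * f x) x = c * prim f x"
  by (simp add: prim_def L2ip_cmult_right)

lemma prim_bound:
  assumes "g \<in> L2" "x \<in> {0..1}"
  shows "\<bar>prim g x\<bar> \<le> L2norm g"
proof -
  have "\<bar>prim g x\<bar> \<le> sqrt x * L2norm g"
    using prim_diff_sqrt[OF assms(1,2), of 0] assms(2) by (simp add: prim_0)
  also have "\<dots> \<le> 1 * L2norm g"
    using assms(2) by (intro mult_right_mono) auto
  finally show ?thesis by simp
qed

text \<open>The Borel sets over which \<open>g\<close> integrates to zero include the intervals,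
  where the integral is an increment of \<open>prim g\<close>, and are closed under complements and
  countable disjoint unions. So \<open>g\<close> and 0 have the same integral over every measurable
  set.\<close>

lemma prim_zero_imp_AE:
  assumes g: "g \<in> L2" and "\<And>x. x \<in> {0..1} \<Longrightarrow> prim g x = 0"
  shows "AE x in UI. g x = 0"
proof -
  have gm [measurable]: "g \<in> borel_measurable UI" using g by (rule L2_measurable)
  define I where "I B = (LINT x:B \<inter> {0..1}|UI. g x)" for B
  have sets: "B \<inter> {0..1} \<in> sets UI" if "B \<in> sets borel" for B :: "real set"
    using that by (auto simp: sets_UI sets_restrict_space)
  have int: "set_integrable UI (B \<inter> {0..1}) g" if "B \<in> sets borel" for B
    unfolding set_integrable_def using integrable_mult_indicator[OF sets[OF that] L2_integrable[OF g]] by simp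
  have tot: "I UNIV = 0"
    using assms(2)[of 1] by (simp add: I_def set_lebesgue_integral_def prim_def L2ip_UI)
  have zero: "I B = 0" if "B \<in> sets borel" for B
    using that
  proof (induction rule: borel_set_induct)
    case empty
    show ?case by (simp add: I_def set_lebesgue_integral_def)
  next
    case (interval a b)
    show ?case
    proof (cases "b < 0 \<or> 1 < a")
      case True
      then have "{a..b} \<inter> {0..1} = {}" by auto
      then show ?thesis by (simp add: I_def set_lebesgue_integral_def)
    next
      case False
      define a' b' where "a' = max a 0" "b' = min b 1"
      have ab: "{a..b} \<inter> {0..1} = {a'..b'}" by (auto simp: a'_b'_def)
      have "a' \<in> {0..1}" "b' \<in> {0..1}" "a' \<le> b'"
        using False interval by (auto simp: a'_b'_def)
      then have "L2ip (indicator {a'..b'}) g = 0"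
        using prim_diff_eq[OF g, of a' b'] assms(2) by auto
      then show ?thesis unfolding I_def ab by (simp add: set_lebesgue_integral_def L2ip_UI)
    qed
  next
    case (compl A)
    have "I UNIV = (LINT x:(A \<inter> {0..1}) \<union> (-A \<inter> {0..1})|UI. g x)"
      unfolding I_def by (rule arg_cong[where f="\<lambda>S. LINT x:S|UI. g x"]) auto
    also have "\<dots> = I A + I (-A)"
      unfolding I_def using compl by (intro set_integral_Un int) auto
    finally show ?case using tot compl by simp
  next
    case (union f)
    have "I (\<Union>i. f i) = (LINT x:(\<Union>i. f i \<inter> {0..1})|UI. g x)"
      unfolding I_def by (rule arg_cong[where f="\<lambda>S. LINT x:S|UI. g x"]) auto
    also have "\<dots> = (\<Sum>i. I (f i))"
      unfolding I_def
    proof (rule lebesgue_integral_countable_add)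
      show "f i \<inter> {0..1} \<in> sets UI" for i by (rule sets) (rule union)
      show "f i \<inter> {0..1} \<inter> (f j \<inter> {0..1}) = {}" if "i \<noteq> j" for i j
        using union(1) that unfolding disjoint_family_on_def by blast
      show "set_integrable UI (\<Union>i. f i \<inter> {0..1}) g"
        using int[of "\<Union>i. f i"] union(2) by (simp add: Int_UN_distrib2)
    qed
    also have "\<dots> = 0" by (simp only: union(3) suminf_zero)
    finally show ?case .
  qed
  have *: "(LINT x:A|UI. g x) = (LINT x:A|UI. 0)" if "A \<in> sets UI" for A
  proof -
  from that have "A \<in> (\<inter>) {0..1} ` sets borel"
    unfolding sets_UI sets_restrict_space .
  then obtain B where B: "B \<in> sets borel" "A = B \<inter> {0..1}"
    unfolding image_iff Int_commute[of "{0..1}"] by (elim bexE)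
  have "(LINT x:A|UI. g x) = I B"
    by (simp only: I_def B(2))
  also have "\<dots> = 0" by (rule zero[OF B(1)])
  also have "0 = (LINT x:A|UI. 0)" by (simp add: set_lebesgue_integral_def)
  finally show ?thesis .
  qed
  show ?thesis
    by (rule density_unique_real[OF L2_integrable[OF g] _ *]) simp_all
qed

text \<open>This makes the choice in \<open>wd\<close> harmless: whatever derivative is selected
  agrees almost everywhere with any other.\<close>

lemma H1_rep_unique:
  assumes "H1_rep u g" "H1_rep u h"
  shows "AE x in UI. g x = h x"
proof -
  have "g \<in> L2" "h \<in> L2" using assms unfolding H1_rep_iff by blast+
  moreover have "prim g x = prim h x" if "x \<in> {0..1}" for x
  proof -
    have "u x = u 0 + prim g x" "u x = u 0 + prim h x"
      using assms that unfolding H1_rep_iff by blast+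
    then show ?thesis by simp
  qed
  ultimately have "AE x in UI. g x - h x = 0"
    by (intro prim_zero_imp_AE) (auto simp: prim_diff)
  then show ?thesis by simp
qed

lemma H1_rep_wd: "u \<in> H1 \<Longrightarrow> H1_rep u (wd u)"
  unfolding H1_def wd_def by (auto intro: someI[of "H1_rep u"])

lemma wd_AE: "H1_rep u g \<Longrightarrow> AE x in UI. wd u x = g x"
  by (rule H1_rep_unique[OF H1_rep_wd]) (auto simp: H1_def)

lemma wd_L2: "u \<in> H1 \<Longrightarrow> wd u \<in> L2"
  using H1_rep_wd[of u] unfolding H1_rep_iff by blast

lemma H1_eq_prim: "u \<in> H1 \<Longrightarrow> x \<in> {0..1} \<Longrightarrow> u x = u 0 + prim (wd u) x"
  using H1_rep_wd unfolding H1_rep_iff by blast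

lemma H1_continuous:
  assumes "u \<in> H1" shows "continuous_on {0..1} u"
proof -
  have "continuous_on {0..1} (\<lambda>x. u 0 + prim (wd u) x)"
    by (rule continuous_on_add[OF continuous_on_const prim_continuous[OF wd_L2[OF assms]]])
  then show ?thesis
    by (rule continuous_on_eq) (rule H1_eq_prim[OF assms, symmetric])
qed

lemma H1_L2: "u \<in> H1 \<Longrightarrow> u \<in> L2"
  by (intro L2_continuous H1_continuous)

lemma H10_imp_H1: "u \<in> H10 \<Longrightarrow> u \<in> H1"
  by (simp add: H10_def)

lemma H10_eq_prim: "u \<in> H10 \<Longrightarrow> x \<in> {0..1} \<Longrightarrow> u x = prim (wd u) x"
  using H1_eq_prim[of u x] by (simp add: H10_def)

lemma H10_mean_zero: "u \<in> H10 \<Longrightarrow> prim (wd u) 1 = 0"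
  using H10_eq_prim[of u 1] by (simp add: H10_def)

lemma H1_rep_prim: "g \<in> L2 \<Longrightarrow> H1_rep (prim g) g"
  by (simp add: H1_rep_iff prim_0)

lemma prim_H10: "g \<in> L2 \<Longrightarrow> prim g 1 = 0 \<Longrightarrow> prim g \<in> H10"
  using H1_rep_prim by (auto simp: H10_def H1_def prim_0)

lemma wd_prim: "g \<in> L2 \<Longrightarrow> AE x in UI. wd (prim g) x = g x"
  by (intro wd_AE H1_rep_prim)

lemma H10_diff:
  assumes "u \<in> H10" "v \<in> H10"
  shows "(\<lambda>x. u x - v x) \<in> H10" "AE x in UI. wd (\<lambda>x. u x - v x) x = wd u x - wd v x"
proof -
  have L: "wd u \<in> L2" "wd v \<in> L2" using assms by (auto intro: wd_L2 H10_imp_H1)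
  have "u x - v x = u 0 - v 0 + prim (\<lambda>x. wd u x - wd v x) x" if "x \<in> {0..1}" for x
    using H10_eq_prim[OF assms(1) that] H10_eq_prim[OF assms(2) that] assms
    by (simp add: prim_diff[OF L] H10_def)
  with L have rep: "H1_rep (\<lambda>x. u x - v x) (\<lambda>x. wd u x - wd v x)"
    unfolding H1_rep_iff by blast
  then show "(\<lambda>x. u x - v x) \<in> H10"
    using assms by (auto simp: H10_def H1_def)
  show "AE x in UI. wd (\<lambda>x. u x - v x) x = wd u x - wd v x"
    by (rule wd_AE[OF rep])
qed

text \<open>One-dimensional Sobolev embedding: \<open>f\<close> varies by at most
  \<open>L2norm (wd f)\<close>, so averaging over \<open>y\<close> bounds
  \<open>\<bar>f x\<bar>\<close> by the mean of \<open>\<bar>f y\<bar>\<close> plus that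
  variation.\<close>

lemma H1_sup_bound:
  assumes "f \<in> H1" "x \<in> {0..1}"
  shows "\<bar>f x\<bar> \<le> 2 * H1norm f"
proof -
  let ?c = "L2norm (wd f)"
  have "\<bar>f x\<bar> - ?c \<le> \<bar>f y\<bar>" if "y \<in> {0..1}" for y
  proof -
    have "\<bar>f x - f y\<bar> = \<bar>prim (wd f) x - prim (wd f) y\<bar>"
      using H1_eq_prim[OF assms] H1_eq_prim[OF assms(1) that] by linarith
    also have "\<dots> \<le> sqrt \<bar>x - y\<bar> * ?c"
      using assms that by (intro prim_diff_sqrt wd_L2)
    also have "\<dots> \<le> 1 * ?c"
      using assms that by (intro mult_right_mono) auto
    finally show ?thesis by simp
  qed
  then have "(\<integral>y. \<bar>f x\<bar> - ?c \<partial>UI) \<le> (\<integral>y. \<bar>f y\<bar> \<partial>UI)"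
    using L2_integrable[OF L2_abs[OF H1_L2[OF assms(1)]]]
    by (intro Bochner_Integration.integral_mono) auto
  also have "\<dots> = L2ip (\<lambda>x. 1) (\<lambda>y. \<bar>f y\<bar>)"
    by (simp add: L2ip_UI)
  also have "\<dots> \<le> L2norm (\<lambda>x. 1) * L2norm (\<lambda>y. \<bar>f y\<bar>)"
    using L2_Cauchy_Schwarz[of "\<lambda>x. 1" "\<lambda>y. \<bar>f y\<bar>"] assms H1_L2 by fastforce
  also have "\<dots> = L2norm f"
    by (simp add: L2norm_const) (simp add: L2norm_def L2ip_def)
  finally have "\<bar>f x\<bar> \<le> L2norm f + ?c" by simp
  moreover have "L2norm f \<le> H1norm f" "?c \<le> H1norm f"
    by (auto simp: L2norm_def H1norm_def L2ip_self_nonneg)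
  ultimately show ?thesis by simp
qed

lemma L2norm_le_H1norm: "L2norm f \<le> H1norm f" "L2norm (wd f) \<le> H1norm f"
  by (auto simp: L2norm_def H1norm_def L2ip_self_nonneg)

section \<open>Exchange of integrals and integration by parts\<close>

lemma Fubini_L2:
  assumes f: "f \<in> L2" and g: "g \<in> L2"
    and K: "(\<lambda>(x, y). K x y) \<in> borel_measurable (UI \<Otimes>\<^sub>M UI)" "\<And>x y. \<bar>K x y\<bar> \<le> B"
  shows "(\<integral>x. f x * (\<integral>y. K x y * g y \<partial>UI) \<partial>UI) = (\<integral>y. g y * (\<integral>x. K x y * f x \<partial>UI) \<partial>UI)"
proof -
  interpret P: pair_sigma_finite UI UI by unfold_locales
  have [measurable]: "f \<in> borel_measurable UI" "g \<in> borel_measurable UI"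
    using f g by (auto intro: L2_measurable)
  have [measurable]: "(\<lambda>(x, y). K x y) \<in> borel_measurable (UI \<Otimes>\<^sub>M UI)" by (rule K)
  have fg: "integrable (UI \<Otimes>\<^sub>M UI) (\<lambda>(x, y). f x * g y)"
    using L2_integrable[OF f] L2_integrable[OF g]
    by (intro P.Fubini_integrable) (auto simp: abs_mult)
  have "integrable (UI \<Otimes>\<^sub>M UI) (\<lambda>(x, y). f x * (K x y * g y))"
  proof (rule Bochner_Integration.integrable_bound)
    show "integrable (UI \<Otimes>\<^sub>M UI) (\<lambda>z. B * (case z of (x, y) \<Rightarrow> f x * g y))"
      by (intro integrable_mult_right fg)
    have "\<bar>K x y\<bar> * \<bar>f x * g y\<bar> \<le> \<bar>B\<bar> * \<bar>f x * g y\<bar>" for x y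
      using K(2)[of x y] by (intro mult_right_mono) auto
    then show "AE z in UI \<Otimes>\<^sub>M UI. norm (case z of (x, y) \<Rightarrow> f x * (K x y * g y))
        \<le> norm (B * (case z of (x, y) \<Rightarrow> f x * g y))"
      by (auto intro!: AE_I2 simp: abs_mult ac_simps)
  qed measurable
  from P.Fubini_integral[OF this]
  show ?thesis
    by (simp add: ac_simps flip: integral_mult_right_zero integral_mult_left_zero)
qed

text \<open>Fubini on the triangle \<open>t \<le> x\<close>, which avoids pointwise derivatives of
  the primitives; the boundary term is the product of the total integrals.\<close>

lemma L2ip_prim:
  assumes "f \<in> L2" "g \<in> L2"
  shows "L2ip f (prim g) = prim f 1 * prim g 1 - L2ip (prim f) g"
proof -
  have "L2ip f (prim g) = (\<integral>x. f x * (\<integral>t. (if t \<le> x then 1 else 0) * g t \<partial>UI) \<partial>UI)"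
    unfolding L2ip_UI prim_def
    by (intro Bochner_Integration.integral_cong refl arg_cong2[of _ _ _ _ "(*)"]) (auto simp: indicator_def)
  also have "\<dots> = (\<integral>t. g t * (\<integral>x. (if t \<le> x then 1 else 0) * f x \<partial>UI) \<partial>UI)"
    by (rule Fubini_L2[where B=1]) (use assms in \<open>auto\<close>)
  also have "\<dots> = L2ip g (\<lambda>t. prim f 1 - prim f t)"
    unfolding L2ip_UI
  proof (intro Bochner_Integration.integral_cong refl arg_cong2[of _ _ _ _ "(*)"])
    fix t assume t: "t \<in> space UI"
    have "(\<integral>x. (if t \<le> x then 1 else 0) * f x \<partial>UI) = L2ip (indicator {t..1}) f"
      unfolding L2ip_UI by (intro Bochner_Integration.integral_cong) (auto simp: indicator_def)
    also have "\<dots> = prim f 1 - prim f t"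
      using prim_diff_eq[OF assms(1), of t 1] t by simp
    finally show "(\<integral>x. (if t \<le> x then 1 else 0) * f x \<partial>UI) = prim f 1 - prim f t" .
  qed
  also have "\<dots> = L2ip g (\<lambda>t. prim f 1) - L2ip g (prim f)"
    using assms by (intro L2ip_diff_right) auto
  also have "L2ip g (\<lambda>t. prim f 1) = prim f 1 * prim g 1"
    by (simp add: prim_1_L2ip L2ip_UI)
  finally show ?thesis by (simp add: L2ip_commute)
qed

section \<open>The Riemann-Liouville kernel\<close>

text \<open>For \<open>b < 0\<close> the integrand is unbounded near \<open>x\<close>. Reflection
  puts the singularity at 0, where the gauge integral of the power is known; nonnegativity turns it
  into a Lebesgue integral.\<close>

lemma has_bochner_integral_powr:
  fixes b x c :: real
  assumes "b > -1" "0 \<le> c" "c \<le> x" "x \<le> 1"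
  shows "has_bochner_integral UI (\<lambda>t. if c \<le> t \<and> t \<le> x then (x - t) powr b else 0)
           ((x - c) powr (b + 1) / (b + 1))"
proof -
  define f where "f s = (if 0 \<le> s \<and> s \<le> x - c then s powr b else 0)" for s :: real
  have "((\<lambda>s. s powr b) has_integral (x - c) powr (b + 1) / (b + 1)) {0..x - c}"
    using assms by (intro has_integral_powr_from_0) auto
  moreover have "f = (\<lambda>s. if s \<in> {0..x - c} then s powr b else 0)"
    by (auto simp: f_def)
  ultimately have h: "(f has_integral (x - c) powr (b + 1) / (b + 1)) UNIV"
    by (simp only: has_integral_restrict_UNIV)
  have m: "f \<in> borel_measurable borel"
    unfolding f_def by measurable
  have nn: "0 \<le> f s" for s by (simp add: f_def)
  have "(\<integral>\<^sup>+s. f s \<partial>lborel) = (x - c) powr (b + 1) / (b + 1)"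
    by (rule nn_integral_has_integral_lborel[OF m nn h])
  then have "has_bochner_integral lborel f ((x - c) powr (b + 1) / (b + 1))"
    using assms m by (intro has_bochner_integral_nn_integral) (auto simp: f_def)
  then have "has_bochner_integral lborel (\<lambda>t. f (x + (-1) * t))
      (((x - c) powr (b + 1) / (b + 1)) /\<^sub>R \<bar>-1\<bar>)"
    by (subst (asm) lborel_has_bochner_integral_real_affine_iff[of "-1" f _ x]) auto
  moreover have "(\<lambda>t. f (x + (-1) * t)) =
      (\<lambda>t. indicator {0..1} t *\<^sub>R (if c \<le> t \<and> t \<le> x then (x - t) powr b else 0))"
    using assms by (auto simp: f_def indicator_def)
  ultimately show ?thesis
    by (simp add: has_bochner_integral_iff UI_def integrable_restrict_space integral_restrict_space)
qed

text \<open>The kernel of the fractional integral of order \<open>\<alpha> - 1\<close>. Extension by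
  zero lets all integrals run over the fixed unit interval; at \<open>t = x\<close> the value 0
  agrees with \<open>0 powr (\<alpha> - 2)\<close>.\<close>

definition kap :: "real \<Rightarrow> real \<Rightarrow> real \<Rightarrow> real" where
  "kap \<alpha> x t = (if t < x then (x - t) powr (\<alpha> - 2) / Gamma (\<alpha> - 1) else 0)"

lemma kap_measurable [measurable]:
  assumes [measurable]: "f \<in> borel_measurable M" "g \<in> borel_measurable M"
  shows "(\<lambda>z. kap \<alpha> (f z) (g z)) \<in> borel_measurable M"
  unfolding kap_def by measurable

lemma kap_nonneg: "1 < \<alpha> \<Longrightarrow> 0 \<le> kap \<alpha> x t"
  by (auto simp: kap_def intro!: divide_nonneg_pos Gamma_real_pos)

lemma RL_eq:
  assumes "x \<in> {0..1}"
  shows "RL \<alpha> w x = L2ip (kap \<alpha> x) (wd w)"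
proof -
  have "L2ip (kap \<alpha> x) (wd w) =
      (\<integral>t. (1 / Gamma (\<alpha> - 1)) * (indicator {0..x} t * ((x - t) powr (\<alpha> - 2) * wd w t)) \<partial>lborel)"
    unfolding L2ip_def set_lebesgue_integral_def
    by (rule Bochner_Integration.integral_cong) (use assms in \<open>auto simp: indicator_def kap_def\<close>)
  then show ?thesis
    by (simp add: RL_def set_lebesgue_integral_def del: times_divide_eq_left)
qed

text \<open>The squared kernel has exponent \<open>2 * \<alpha> - 4\<close>, which exceeds -1
  exactly when \<open>\<alpha> > 3/2\<close>. The explicit power of \<open>x - c\<close> measures
  the kernel near its singularity.\<close>

lemma
  assumes "3/2 < \<alpha>" "x \<in> {0..1}" "c \<in> {0..x}"
  shows kap_tail_L2: "(\<lambda>t. indicator {c..x} t * kap \<alpha> x t) \<in> L2"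
    and kap_tail_norm: "L2norm (\<lambda>t. indicator {c..x} t * kap \<alpha> x t) =
      (x - c) powr (\<alpha> - 3/2) / (Gamma (\<alpha> - 1) * sqrt (2 * \<alpha> - 3))"
proof -
  define G where "G = Gamma (\<alpha> - 1)"
  have G: "G > 0" using assms by (auto simp: G_def intro!: Gamma_real_pos)
  have i: "has_bochner_integral UI (\<lambda>t. if c \<le> t \<and> t \<le> x then (x - t) powr (2 * \<alpha> - 4) else 0)
      ((x - c) powr (2 * \<alpha> - 4 + 1) / (2 * \<alpha> - 4 + 1))"
    using assms by (intro has_bochner_integral_powr) auto
  have i': "has_bochner_integral UI (\<lambda>t. (indicator {c..x} t * kap \<alpha> x t) * (indicator {c..x} t * kap \<alpha> x t))
      (inverse (G\<^sup>2) * ((x - c) powr (2 * \<alpha> - 4 + 1) / (2 * \<alpha> - 4 + 1)))"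
  proof (rule has_bochner_integral_cong[THEN iffD1, OF refl _ refl has_bochner_integral_mult_right[OF i]])
    fix t
    have "((x - t) powr (\<alpha> - 2))\<^sup>2 = (x - t) powr (2 * \<alpha> - 4)"
      by (simp add: power2_eq_square powr_add[symmetric])
    then show "inverse (G\<^sup>2) * (if c \<le> t \<and> t \<le> x then (x - t) powr (2 * \<alpha> - 4) else 0) =
        (indicator {c..x} t * kap \<alpha> x t) * (indicator {c..x} t * kap \<alpha> x t)"
      using G by (auto simp: kap_def indicator_def power2_eq_square G_def field_simps)
  qed
  have m: "(\<lambda>t. indicator {c..x} t * kap \<alpha> x t) \<in> borel_measurable UI"
    by measurable
  with i' show "(\<lambda>t. indicator {c..x} t * kap \<alpha> x t) \<in> L2"
    unfolding L2_def power2_eq_square has_bochner_integral_iff by blast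
  have "L2norm (\<lambda>t. indicator {c..x} t * kap \<alpha> x t) = sqrt (inverse (G\<^sup>2) * ((x - c) powr (2 * \<alpha> - 3) / (2 * \<alpha> - 3)))"
    using i' by (simp add: L2norm_def L2ip_UI has_bochner_integral_iff)
  also have "\<dots> = (sqrt ((x - c) powr (2 * \<alpha> - 3))) / (G * sqrt (2 * \<alpha> - 3))"
    using G by (simp add: real_sqrt_mult real_sqrt_divide real_sqrt_inverse divide_inverse)
  also have "sqrt ((x - c) powr (2 * \<alpha> - 3)) = (x - c) powr (\<alpha> - 3/2)"
    using assms by (simp add: powr_half_sqrt[symmetric] powr_powr algebra_simps)
  finally show "L2norm (\<lambda>t. indicator {c..x} t * kap \<alpha> x t) =
      (x - c) powr (\<alpha> - 3/2) / (Gamma (\<alpha> - 1) * sqrt (2 * \<alpha> - 3))"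
    by (simp add: G_def)
qed

text \<open>For \<open>\<alpha> > 3/2\<close> this is the norm of \<open>kap \<alpha> 1\<close>, the
  largest among the kernels \<open>kap \<alpha> x\<close> with \<open>x\<close> in the unit
  interval.\<close>

definition ck :: "real \<Rightarrow> real" where
  "ck \<alpha> = 1 / (Gamma (\<alpha> - 1) * sqrt (2 * \<alpha> - 3))"

lemma ck_nonneg: "3/2 < \<alpha> \<Longrightarrow> 0 \<le> ck \<alpha>"
  by (auto simp: ck_def intro!: divide_nonneg_nonneg mult_nonneg_nonneg less_imp_le[OF Gamma_real_pos])

lemma
  assumes "3/2 < \<alpha>" "x \<in> {0..1}"
  shows kap_L2: "kap \<alpha> x \<in> L2"
    and kap_norm: "L2norm (kap \<alpha> x) \<le> ck \<alpha>"
proof -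
  have *: "indicator {0..x} t * kap \<alpha> x t = kap \<alpha> x t" if "t \<in> {0..1}" for t
    using that by (auto simp: indicator_def kap_def)
  show "kap \<alpha> x \<in> L2"
    by (rule L2_cong[OF kap_tail_L2[OF assms, of 0] *]) (use assms in auto)
  have "L2norm (kap \<alpha> x) = L2norm (\<lambda>t. indicator {0..x} t * kap \<alpha> x t)"
    by (rule L2norm_cong) (use * in simp)
  also have "\<dots> = x powr (\<alpha> - 3/2) * ck \<alpha>"
    using kap_tail_norm[OF assms, of 0] assms by (simp add: ck_def)
  also have "\<dots> \<le> 1 * ck \<alpha>"
    using assms by (intro mult_right_mono ck_nonneg powr_le1) auto
  finally show "L2norm (kap \<alpha> x) \<le> ck \<alpha>" by simp
qed

text \<open>On the unit interval \<open>Rop \<alpha> (wd w)\<close> is \<open>RL \<alpha> w\<close>,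
  by \<open>RL_eq\<close>; without \<open>wd\<close> it becomes an operator on all of
  \<open>L2\<close>.\<close>

definition Rop :: "real \<Rightarrow> (real \<Rightarrow> real) \<Rightarrow> real \<Rightarrow> real" where
  "Rop \<alpha> g x = L2ip (kap \<alpha> x) g"

lemma Rop_measurable:
  assumes g: "g \<in> borel_measurable UI"
  shows "Rop \<alpha> g \<in> borel_measurable UI"
  unfolding Rop_def[abs_def] L2ip_UI
proof (rule UI.borel_measurable_lebesgue_integral)
  have "fst \<in> borel_measurable (UI \<Otimes>\<^sub>M UI)" "snd \<in> borel_measurable (UI \<Otimes>\<^sub>M UI)"
    using measurable_compose[OF measurable_fst ident_measurable_UI, of UI]
      measurable_compose[OF measurable_snd ident_measurable_UI, of UI] by simp_all
  then have "(\<lambda>z. kap \<alpha> (fst z) (snd z)) \<in> borel_measurable (UI \<Otimes>\<^sub>M UI)"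
    by (rule kap_measurable)
  moreover have "(\<lambda>z. g (snd z)) \<in> borel_measurable (UI \<Otimes>\<^sub>M UI)"
    by (rule measurable_compose[OF measurable_snd g])
  ultimately show "(\<lambda>(x, y). kap \<alpha> x y * g y) \<in> borel_measurable (UI \<Otimes>\<^sub>M UI)"
    unfolding case_prod_beta by (rule borel_measurable_times)
qed

lemma Rop_bound:
  assumes "3/2 < \<alpha>" "g \<in> L2" "x \<in> {0..1}"
  shows "\<bar>Rop \<alpha> g x\<bar> \<le> ck \<alpha> * L2norm g"
proof -
  have "\<bar>Rop \<alpha> g x\<bar> \<le> L2norm (kap \<alpha> x) * L2norm g"
    unfolding Rop_def by (rule L2_Cauchy_Schwarz[OF kap_L2[OF assms(1,3)] assms(2)])
  also have "\<dots> \<le> ck \<alpha> * L2norm g"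
    by (rule mult_right_mono[OF kap_norm[OF assms(1,3)] L2norm_nonneg])
  finally show ?thesis .
qed

section \<open>The bilinear form\<close>

locale fractional_form =
  fixes \<alpha> :: real and q p :: "real \<Rightarrow> real"
  assumes alpha: "3/2 < \<alpha>" "\<alpha> < 2"
    and q_H1: "q \<in> H1" and p_H1: "p \<in> H1"
begin

abbreviation "R \<equiv> Rop \<alpha>"

text \<open>For \<open>g = wd \<psi>\<close> this is the density of the lower order terms: paired
  with \<open>\<phi>\<close> it gives the last two summands of \<open>Aform\<close>, the value at 1
  entering through a rank-one term.\<close>

definition N :: "(real \<Rightarrow> real) \<Rightarrow> real \<Rightarrow> real" where
  "N g x = q x * R g x + R g 1 * p x"

text \<open>Up to its mean, \<^term>\<open>T g\<close> is the primitive of \<^term>\<open>N g\<close>. Integrating the lower order terms of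
  the form by parts turns \<open>A(\<psi>, \<phi>)\<close> into \<open>(\<psi>' - T \<psi>', \<phi>')\<close>, see \<open>Aform_eq\<close>; subtracting the mean makes
  \<open>T\<close> act on the mean-zero functions, that is, on the derivatives of \<open>H10\<close>.\<close>

definition T :: "(real \<Rightarrow> real) \<Rightarrow> real \<Rightarrow> real" where
  "T g x = prim (N g) x - L2ip (\<lambda>x. 1) (prim (N g))"

definition cqp :: real where
  "cqp = 2 * H1norm q + 2 * H1norm p"

definition CN :: real where
  "CN = cqp * ck \<alpha>"

lemma cqp_nonneg: "0 \<le> cqp"
  by (auto simp: cqp_def H1norm_def L2ip_self_nonneg)

lemma CN_nonneg: "0 \<le> CN"
  unfolding CN_def by (intro mult_nonneg_nonneg cqp_nonneg ck_nonneg alpha)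

lemma N_bound_of_R_bound:
  assumes "x \<in> {0..1}" "\<And>y. y \<in> {0..1} \<Longrightarrow> \<bar>R g y\<bar> \<le> b"
  shows "\<bar>N g x\<bar> \<le> cqp * b"
proof -
  have "0 \<le> b" using assms(2)[of 1] by simp
  have "\<bar>N g x\<bar> \<le> \<bar>q x\<bar> * \<bar>R g x\<bar> + \<bar>R g 1\<bar> * \<bar>p x\<bar>"
    unfolding N_def by (rule order_trans[OF abs_triangle_ineq]) (simp add: abs_mult)
  also have "\<dots> \<le> (2 * H1norm q) * b + b * (2 * H1norm p)"
    using assms \<open>0 \<le> b\<close> H1_sup_bound[OF q_H1 assms(1)] H1_sup_bound[OF p_H1 assms(1)] assms(2)[of 1]
    by (intro add_mono mult_mono) auto
  finally show ?thesis by (simp add: cqp_def algebra_simps)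
qed

lemma N_bound: "g \<in> L2 \<Longrightarrow> x \<in> {0..1} \<Longrightarrow> \<bar>N g x\<bar> \<le> CN * L2norm g"
  unfolding CN_def mult.assoc
  by (rule N_bound_of_R_bound) (simp, rule Rop_bound[OF alpha(1)])

lemma N_L2 [intro]:
  assumes "g \<in> L2" shows "N g \<in> L2"
proof (rule L2_bounded)
  have [measurable]: "R g \<in> borel_measurable UI" "q \<in> borel_measurable UI" "p \<in> borel_measurable UI"
    by (rule Rop_measurable L2_measurable assms H1_L2 q_H1 p_H1)+
  show "N g \<in> borel_measurable UI" unfolding N_def[abs_def] by measurable
qed (rule N_bound[OF assms])

lemma T_Lipschitz:
  assumes "g \<in> L2" "x \<in> {0..1}" "y \<in> {0..1}"
  shows "\<bar>T g x - T g y\<bar> \<le> CN * L2norm g * \<bar>x - y\<bar>"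
  using prim_diff_bound[OF N_L2[OF assms(1)] assms(2,3) N_bound[OF assms(1)]] by (simp add: T_def)

lemma T_continuous: "g \<in> L2 \<Longrightarrow> continuous_on {0..1} (T g)"
  unfolding T_def by (rule continuous_on_diff[OF prim_continuous[OF N_L2] continuous_on_const])

lemma T_L2 [intro]: "g \<in> L2 \<Longrightarrow> T g \<in> L2"
  by (rule L2_continuous[OF T_continuous])

lemma T_mean: "g \<in> L2 \<Longrightarrow> L2ip (\<lambda>x. 1) (T g) = 0"
  unfolding T_def by (subst L2ip_diff_right) (auto simp: L2ip_UI)

text \<open>The bound on \<open>R g\<close> is left open: the generic one makes \<open>T\<close>
  bounded, and the smaller one for functions orthogonal to piecewise constants makes
  \<open>T g\<close> small. The factor 2 counts the primitive and its subtracted mean.\<close>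

lemma T_bound_of_R_bound:
  assumes g: "g \<in> L2" and x: "x \<in> {0..1}" and b: "\<And>y. y \<in> {0..1} \<Longrightarrow> \<bar>R g y\<bar> \<le> b"
  shows "\<bar>T g x\<bar> \<le> 2 * cqp * b"
proof -
  have *: "\<bar>prim (N g) y\<bar> \<le> cqp * b" if "y \<in> {0..1}" for y
  proof -
    have "0 \<le> cqp * b" using cqp_nonneg b[of 1] by simp
    have "\<bar>prim (N g) y\<bar> \<le> cqp * b * y"
      using prim_diff_bound[OF N_L2[OF g] that, of 0 "cqp * b"] N_bound_of_R_bound[of _ g b] b that
      by (simp add: prim_0)
    also have "\<dots> \<le> cqp * b * 1"
      using that \<open>0 \<le> cqp * b\<close> by (intro mult_left_mono) auto
    finally show ?thesis by simp
  qed
  have "\<bar>L2ip (\<lambda>x. 1) (prim (N g))\<bar> \<le> L2norm (\<lambda>x. 1) * L2norm (prim (N g))"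
    using g by (intro L2_Cauchy_Schwarz) auto
  also have "\<dots> \<le> cqp * b"
    using L2norm_bounded[OF L2_measurable[OF prim_L2[OF N_L2[OF g]]] *] by (simp add: L2norm_const)
  finally show ?thesis using *[OF x] unfolding T_def by linarith
qed

lemma T_bound: "g \<in> L2 \<Longrightarrow> x \<in> {0..1} \<Longrightarrow> \<bar>T g x\<bar> \<le> 2 * CN * L2norm g"
  using T_bound_of_R_bound[of g x "ck \<alpha> * L2norm g"] Rop_bound[OF alpha(1), of g]
  unfolding CN_def by (simp only: mult.assoc)

lemma R_diff: "f \<in> L2 \<Longrightarrow> g \<in> L2 \<Longrightarrow> x \<in> {0..1} \<Longrightarrow> R (\<lambda>x. f x - g x) x = R f x - R g x"
  unfolding Rop_def by (rule L2ip_diff_right[OF _ _ kap_L2[OF alpha(1)]])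

lemma N_diff: "f \<in> L2 \<Longrightarrow> g \<in> L2 \<Longrightarrow> x \<in> {0..1} \<Longrightarrow> N (\<lambda>x. f x - g x) x = N f x - N g x"
  by (simp add: N_def R_diff algebra_simps)

lemma T_cong_N:
  assumes "\<And>x. x \<in> {0..1} \<Longrightarrow> N f x = N g x"
  shows "T f = T g"
proof -
  have "prim (N f) = prim (N g)"
    unfolding prim_def by (rule ext, rule L2ip_cong) (simp_all only: assms)
  then show ?thesis by (auto simp: T_def)
qed

text \<open>Weak derivatives are fixed only up to null sets. \<open>T\<close> sees them through
  integrals alone, so its values agree at every point, not just almost everywhere.\<close>

lemma T_cong_AE:
  assumes "f \<in> L2" "g \<in> L2" "AE x in UI. f x = g x"
  shows "T f = T g"
proof (rule T_cong_N)
  have "R f x = R g x" if "x \<in> {0..1}" for x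
    unfolding Rop_def using L2ip_cong_AE[OF assms(1,2) kap_L2[OF alpha(1) that] assms(3)]
    by (simp add: L2ip_commute)
  then show "N f x = N g x" if "x \<in> {0..1}" for x using that by (simp add: N_def)
qed

lemma T_diff:
  assumes "f \<in> L2" "g \<in> L2"
  shows "T (\<lambda>x. f x - g x) x = T f x - T g x"
proof -
  have "prim (N (\<lambda>x. f x - g x)) = prim (\<lambda>x. N f x - N g x)"
    unfolding prim_def by (rule ext, rule L2ip_cong) (simp_all only: N_diff[OF assms])
  also have "\<dots> = (\<lambda>x. prim (N f) x - prim (N g) x)"
    using assms by (auto simp: prim_diff N_L2)
  finally show ?thesis
    using assms by (simp add: T_def L2ip_diff_right prim_L2 N_L2)
qed

lemma T_cmult: "T (\<lambda>x. c * f x) x = c * T f x"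
proof -
  have "N (\<lambda>x. c * f x) = (\<lambda>x. c * N f x)"
    by (auto simp: N_def Rop_def L2ip_cmult_right algebra_simps)
  moreover have "prim (\<lambda>x. c * N f x) = (\<lambda>x. c * prim (N f) x)"
    by (auto simp: prim_cmult)
  ultimately show ?thesis
    by (simp add: T_def L2ip_cmult_right right_diff_distrib)
qed

lemma Aform_eq:
  assumes "\<psi> \<in> H10" "\<phi> \<in> H10"
  shows "Aform \<alpha> q p \<psi> \<phi> = L2ip (\<lambda>x. wd \<psi> x - T (wd \<psi>) x) (wd \<phi>)"
proof -
  let ?u = "wd \<psi>"
  have u: "?u \<in> L2" and v: "wd \<phi> \<in> L2" and phi: "\<phi> \<in> L2"
    by (rule wd_L2 H1_L2 H10_imp_H1 assms)+
  have qR: "(\<lambda>x. q x * R ?u x) \<in> L2"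
  proof (rule L2_mult_bounded)
    show "R ?u \<in> L2"
      by (rule L2_bounded[OF Rop_measurable[OF L2_measurable[OF u]] Rop_bound[OF alpha(1) u]])
    show "q \<in> borel_measurable UI" by (rule L2_measurable[OF H1_L2[OF q_H1]])
  qed (rule H1_sup_bound[OF q_H1])
  have "L2ip (RL \<alpha> \<psi>) (\<lambda>x. q x * \<phi> x) = L2ip (\<lambda>x. q x * R ?u x) \<phi>"
    unfolding L2ip_UI by (rule Bochner_Integration.integral_cong) (auto simp: RL_eq Rop_def)
  moreover have "RL \<alpha> \<psi> 1 * L2ip p \<phi> = L2ip (\<lambda>x. R ?u 1 * p x) \<phi>"
    by (simp add: L2ip_cmult_left RL_eq Rop_def)
  ultimately have "L2ip (RL \<alpha> \<psi>) (\<lambda>x. q x * \<phi> x) + RL \<alpha> \<psi> 1 * L2ip p \<phi> = L2ip (N ?u) \<phi>"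
    using L2ip_add_left[OF qR L2_cmult[OF H1_L2[OF p_H1]] phi] by (simp add: N_def[abs_def])
  also have "\<dots> = L2ip (N ?u) (prim (wd \<phi>))"
    by (rule L2ip_cong[OF refl H10_eq_prim[OF assms(2)]])
  also have "\<dots> = - L2ip (prim (N ?u)) (wd \<phi>)"
    by (simp add: L2ip_prim[OF N_L2[OF u] v] H10_mean_zero[OF assms(2)])
  \<comment> \<open>\<open>prim (N ?u)\<close> and \<open>T ?u\<close> differ by a constant, which
    is orthogonal to the mean-zero function \<open>wd \<phi>\<close>.\<close>
  also have "\<dots> = - L2ip (T ?u) (wd \<phi>)"
  proof -
    have "L2ip (\<lambda>x. c) (wd \<phi>) = 0" for c
      using H10_mean_zero[OF assms(2)] L2ip_cmult_left[of c "\<lambda>x. 1" "wd \<phi>"] by (simp add: prim_1_L2ip)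
    then show ?thesis
      using L2ip_diff_left[OF prim_L2[OF N_L2[OF u]] L2_const v] by (simp add: T_def[abs_def])
  qed
  finally show ?thesis
    using L2ip_diff_left[OF u T_L2[OF u] v] by (simp add: Aform_def)
qed

end

text \<open>A mean-zero \<open>g\<close> is the derivative of \<open>prim g\<close>, which lies in
  \<open>H10\<close>, so \<open>g\<close> may be tested against itself.\<close>

lemma orthogonal_H10_imp_AE:
  assumes g: "g \<in> L2" and "L2ip (\<lambda>x. 1) g = 0" and o: "\<And>\<phi>. \<phi> \<in> H10 \<Longrightarrow> L2ip g (wd \<phi>) = 0"
  shows "AE x in UI. g x = 0"
proof (rule L2ip_zero_imp_AE[OF g])
  have h: "prim g \<in> H10" using assms(2) by (intro prim_H10[OF g]) (simp add: prim_1_L2ip)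
  then have "L2ip g (wd (prim g)) = 0" by (rule o)
  then show "L2ip g g = 0"
    using L2ip_cong_AE[OF wd_L2[OF H10_imp_H1[OF h]] g g wd_prim[OF g]] by (simp add: L2ip_commute)
qed

text \<open>The kernel as a function of the distance \<open>s\<close> to the singularity; the reflection makes its
  \<open>L2\<close> bounds instances of those of \<^const>\<open>kap\<close>.\<close>

definition sk :: "real \<Rightarrow> real \<Rightarrow> real" where
  "sk \<alpha> s = kap \<alpha> 1 (1 - s)"

lemma integral_UI_reflect:
  fixes f :: "real \<Rightarrow> real"
  shows "integral\<^sup>L UI (\<lambda>s. f (1 - s)) = integral\<^sup>L UI f"
proof -
  have "integral\<^sup>L UI f = (\<integral>s. indicator {0..1} (1 + (-1) * s) * f (1 + (-1) * s) \<partial>lborel)"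
    unfolding integral_UI set_lebesgue_integral_def
    by (subst lborel_integral_real_affine[of "-1" _ 1]) auto
  also have "\<dots> = integral\<^sup>L UI (\<lambda>s. f (1 - s))"
    unfolding integral_UI set_lebesgue_integral_def
    by (rule Bochner_Integration.integral_cong) (auto simp: indicator_def)
  finally show ?thesis by simp
qed

lemma integrable_UI_reflect:
  fixes f :: "real \<Rightarrow> real"
  assumes "integrable UI f"
  shows "integrable UI (\<lambda>s. f (1 - s))"
proof -
  have "integrable lborel (\<lambda>s. indicator {0..1} (1 + (-1) * s) *\<^sub>R f (1 + (-1) * s))"
    using assms unfolding integrable_UI set_integrable_def
    by (rule lborel_integrable_real_affine) simp
  moreover have "(\<lambda>s. indicator {0..1} (1 + (-1) * s) *\<^sub>R f (1 + (-1) * s)) =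
      (\<lambda>s. indicator {0..1} s *\<^sub>R f (1 - s))"
    by (auto simp: indicator_def)
  ultimately show ?thesis
    unfolding integrable_UI set_integrable_def by simp
qed

lemma sk_measurable: "sk \<alpha> \<in> borel_measurable UI"
  unfolding sk_def[abs_def] by measurable

lemma sk_L2:
  assumes "3/2 < \<alpha>" shows "sk \<alpha> \<in> L2"
proof -
  have "integrable UI (\<lambda>s. (kap \<alpha> 1 s)\<^sup>2)"
    using kap_L2[OF assms, of 1] by (simp add: L2_def)
  from integrable_UI_reflect[OF this] show ?thesis
    by (simp add: L2_def sk_measurable) (simp add: sk_def)
qed

lemma sk_norm:
  assumes "3/2 < \<alpha>" shows "L2norm (sk \<alpha>) \<le> ck \<alpha>"
proof -
  have "L2norm (sk \<alpha>) = L2norm (kap \<alpha> 1)"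
    unfolding L2norm_def L2ip_UI sk_def
    by (subst integral_UI_reflect[of "\<lambda>s. kap \<alpha> 1 s * kap \<alpha> 1 s"]) simp
  then show ?thesis using kap_norm[OF assms, of 1] by simp
qed

text \<open>Substituting \<open>s = y - t\<close> frees the kernel of \<open>y\<close>; the price is
  the extension of \<open>u\<close> by zero, which may jump at the ends of the interval.\<close>

lemma Rop_convolution:
  assumes "y \<in> {0..1}"
  shows "Rop \<alpha> u y = L2ip (sk \<alpha>) (\<lambda>s. indicator {0..1} (y - s) * u (y - s))"
proof -
  have "Rop \<alpha> u y = (\<integral>s. indicator {0..1} (y + (-1) * s) * (kap \<alpha> y (y + (-1) * s) * u (y + (-1) * s)) \<partial>lborel)"
    unfolding Rop_def L2ip_def set_lebesgue_integral_def
    by (subst lborel_integral_real_affine[of "-1" _ y]) auto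
  also have "\<dots> = L2ip (sk \<alpha>) (\<lambda>s. indicator {0..1} (y - s) * u (y - s))"
    unfolding L2ip_def set_lebesgue_integral_def
    by (rule Bochner_Integration.integral_cong)
       (use assms in \<open>auto simp: indicator_def sk_def kap_def\<close>)
  finally show ?thesis .
qed

text \<open>In convolution form the increment falls on \<open>u\<close>, except on \<open>{z..y}\<close> where only the kernel is left;
  the kernel is square integrable because \<open>\<alpha> > 3/2\<close>.\<close>

lemma Rop_increment:
  assumes a: "3/2 < \<alpha>" and u: "u \<in> L2" and zy: "0 \<le> z" "z \<le> y" "y \<le> 1"
    and B: "\<And>x. x \<in> {0..1} \<Longrightarrow> \<bar>u x\<bar> \<le> B"
    and L: "0 \<le> L" "\<And>x y. x \<in> {0..1} \<Longrightarrow> y \<in> {0..1} \<Longrightarrow> \<bar>u x - u y\<bar> \<le> L * \<bar>x - y\<bar>"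
  shows "\<bar>Rop \<alpha> u y - Rop \<alpha> u z\<bar> \<le> L2ip (indicator {z..y}) (\<lambda>s. L * ck \<alpha> + B * sk \<alpha> s)"
proof -
  define U where "U x = indicator {0..1} x * u x" for x
  have B0: "0 \<le> B" using B[of 0] by simp
  have U: "U \<in> borel_measurable borel"
    using L2_measurable[OF u] unfolding U_def[abs_def] measurable_UI_iff .
  have Ub: "\<bar>U x\<bar> \<le> B" for x using B[of x] B0 by (auto simp: U_def indicator_def)
  have UL: "(\<lambda>s. U (t - s)) \<in> L2" for t
  proof (rule L2_bounded)
    show "(\<lambda>s. U (t - s)) \<in> borel_measurable UI"
      by (rule measurable_compose[OF _ U]) measurable
  qed (rule Ub)
  note s = sk_L2[OF a]
  have ind: "L2ip (indicator {z..y}) (\<lambda>s. 1) = y - z"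
    using zy by (simp add: L2ip_UI Int_absorb2 UI_def measure_restrict_space)
  have D: "(\<lambda>s. L * (y - z) + B * indicator {z..y} s) \<in> L2"
    by (rule L2_add[OF L2_const L2_cmult[OF L2_indicator]])
  have "Rop \<alpha> u y - Rop \<alpha> u z = L2ip (sk \<alpha>) (\<lambda>s. U (y - s) - U (z - s))"
    using zy by (subst L2ip_diff_right[OF UL UL s]) (simp add: Rop_convolution U_def)
  also have "\<bar>\<dots>\<bar> \<le> L2ip (sk \<alpha>) (\<lambda>s. L * (y - z) + B * indicator {z..y} s)"
  proof (rule L2ip_abs_le[OF s L2_diff[OF UL UL] D])
    show "0 \<le> sk \<alpha> x" for x using a by (simp add: sk_def kap_nonneg)
    show "\<bar>U (y - x) - U (z - x)\<bar> \<le> L * (y - z) + B * indicator {z..y} x" if x: "x \<in> {0..1}" for x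
    proof -
      have "0 \<le> L * (y - z)" using L(1) zy by simp
      \<comment> \<open>For \<open>x \<le> z\<close> both arguments lie in the unit interval and the
        Lipschitz bound applies; for \<open>z < x \<le> y\<close> only \<open>y - x\<close> does,
        and the jump of the zero extension costs \<open>B\<close>; beyond \<open>y\<close> both
        values are 0.\<close>
      consider "x \<le> z" | "z < x" "x \<le> y" | "y < x" by linarith
      then show ?thesis
      proof cases
        case 1
        then have "y - x \<in> {0..1}" "z - x \<in> {0..1}" using x zy by auto
        then have "\<bar>U (y - x) - U (z - x)\<bar> \<le> L * (y - z)"
          using L(2)[of "y - x" "z - x"] zy by (simp add: U_def)
        then show ?thesis using B0 by (auto simp: indicator_def)
      next
        case 2
        then show ?thesis using Ub[of "y - x"] \<open>0 \<le> L * (y - z)\<close> by (simp add: U_def[of "z - x"])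
      next
        case 3
        then show ?thesis using zy \<open>0 \<le> L * (y - z)\<close> by (simp add: U_def)
      qed
    qed
  qed
  also have "\<dots> = L * (y - z) * L2ip (\<lambda>x. 1) (sk \<alpha>) + B * L2ip (indicator {z..y}) (sk \<alpha>)"
    using L2ip_add_right[OF L2_const L2_cmult[OF L2_indicator] s, of "L * (y - z)" B z y]
      L2ip_cmult_right[of "sk \<alpha>" "L * (y - z)" "\<lambda>x. 1"] L2ip_cmult_right[of "sk \<alpha>" B "indicator {z..y}"]
    by (simp add: L2ip_commute[of "sk \<alpha>"])
  also have "L * (y - z) * L2ip (\<lambda>x. 1) (sk \<alpha>) \<le> L * (y - z) * ck \<alpha>"
  proof (rule mult_left_mono)
    show "L2ip (\<lambda>x. 1) (sk \<alpha>) \<le> ck \<alpha>"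
      using L2_Cauchy_Schwarz[OF L2_const s, of 1] sk_norm[OF a] by (simp add: L2norm_const)
  qed (use L zy in simp)
  \<comment> \<open>\<open>y - z\<close> is the integral of 1 over \<open>{z..y}\<close>, so both
    terms merge into one integral over that interval.\<close>
  also have "L * (y - z) * ck \<alpha> + B * L2ip (indicator {z..y}) (sk \<alpha>)
      = L2ip (indicator {z..y}) (\<lambda>s. L * ck \<alpha> + B * sk \<alpha> s)"
    using L2ip_add_right[OF L2_const L2_cmult[OF s] L2_indicator, of z y "L * ck \<alpha>" B]
      L2ip_cmult_right[of "indicator {z..y}" "L * ck \<alpha>" "\<lambda>x. 1"]
      L2ip_cmult_right[of "indicator {z..y}" B "sk \<alpha>"]
    by (simp add: ind)
  finally show ?thesis by simp
qed

section \<open>Stability and regularity\<close>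

locale fractional_problem = fractional_form +
  assumes unique: "\<And>w. w \<in> H10 \<Longrightarrow> (\<And>v. v \<in> H10 \<Longrightarrow> Aform \<alpha> q p w v = 0) \<Longrightarrow> \<forall>y\<in>{0..1}. w y = 0"
begin

text \<open>By \<open>g = T g\<close> the form vanishes on \<open>prim g\<close> for every test
  function, so uniqueness gives \<open>g = 0\<close> almost everywhere. Then \<open>T g = 0\<close>
  at every point, and the equation itself carries this over to \<open>g\<close>.\<close>

lemma kernel_trivial:
  assumes g: "g \<in> L2" and m: "L2ip (\<lambda>x. 1) g = 0" and e: "\<And>x. x \<in> {0..1} \<Longrightarrow> g x = T g x"
    and x: "x \<in> {0..1}"
  shows "g x = 0"
proof -
  have w: "prim g \<in> H10" using m by (intro prim_H10[OF g]) (simp add: prim_1_L2ip)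
  note W = wd_L2[OF H10_imp_H1[OF w]]
  have TT: "T (wd (prim g)) = T g" by (rule T_cong_AE[OF W g wd_prim[OF g]])
  have "Aform \<alpha> q p (prim g) v = 0" if v: "v \<in> H10" for v
  proof -
    note V = wd_L2[OF H10_imp_H1[OF v]]
    have "Aform \<alpha> q p (prim g) v = L2ip (\<lambda>x. wd (prim g) x - T g x) (wd v)"
      by (simp add: Aform_eq[OF w v] TT)
    also have "\<dots> = L2ip (\<lambda>x. g x - T g x) (wd v)"
      by (rule L2ip_cong_AE[OF L2_diff[OF W T_L2[OF g]] L2_diff[OF g T_L2[OF g]] V])
         (use wd_prim[OF g] in \<open>auto elim!: eventually_mono\<close>)
    also have "\<dots> = L2ip (\<lambda>x. 0) (wd v)"
      by (rule L2ip_cong) (use e in simp_all)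
    finally show ?thesis by (simp add: L2ip_UI)
  qed
  then have "\<forall>y\<in>{0..1}. prim g y = 0" by (rule unique[OF w])
  then have "AE x in UI. g x = 0" by (intro prim_zero_imp_AE[OF g]) auto
  then have "T g = T (\<lambda>x. 0)" by (rule T_cong_AE[OF g L2_const])
  moreover have "T (\<lambda>x. 0) x = 0"
    using T_bound[OF L2_const x, of 0] by (simp add: L2norm_const)
  ultimately show ?thesis using e[OF x] by simp
qed

text \<open>By contradiction: normalized counterexamples \<open>v n\<close> satisfy \<open>v n - T (v n) \<rightarrow> 0\<close>, and the functions
  \<open>T (v n)\<close> are equi-Lipschitz, so a subsequence converges uniformly to a nonzero solution of \<open>g = T g\<close>.\<close>

lemma stability:
  "\<exists>C\<ge>0. \<forall>u b. continuous_on {0..1} u \<longrightarrow> L2ip (\<lambda>x. 1) u = 0 \<longrightarrow>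
     (\<forall>x\<in>{0..1}. \<bar>u x - T u x\<bar> \<le> b) \<longrightarrow> (\<forall>x\<in>{0..1}. \<bar>u x\<bar> \<le> C * b)"
proof (rule ccontr)
  assume neg: "\<not> ?thesis"
  have "\<exists>v y. continuous_on {0..1} v \<and> L2ip (\<lambda>x. 1) v = 0 \<and> (\<forall>x\<in>{0..1}. \<bar>v x\<bar> \<le> 1) \<and>
      (\<forall>x\<in>{0..1}. \<bar>v x - T v x\<bar> \<le> 1 / real (Suc n)) \<and> y \<in> {0..1} \<and> \<bar>v y\<bar> = 1" for n
  proof -
    have "\<not> (\<forall>u b. continuous_on {0..1} u \<longrightarrow> L2ip (\<lambda>x. 1) u = 0 \<longrightarrow>
       (\<forall>x\<in>{0..1}. \<bar>u x - T u x\<bar> \<le> b) \<longrightarrow> (\<forall>x\<in>{0..1}. \<bar>u x\<bar> \<le> real (Suc n) * b))"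
      using neg of_nat_0_le_iff by blast
    then obtain u b x where u: "continuous_on {0..1} u" "L2ip (\<lambda>x. 1) u = 0"
      and b: "\<And>x. x \<in> {0..1} \<Longrightarrow> \<bar>u x - T u x\<bar> \<le> b"
      and x: "x \<in> {0..1}" "real (Suc n) * b < \<bar>u x\<bar>"
      unfolding not_all not_imp bex_simps ball_simps not_le by blast
    have "\<exists>y\<in>{0..1}. \<forall>z\<in>{0..1}. \<bar>u z\<bar> \<le> \<bar>u y\<bar>"
      using u(1) by (intro continuous_attains_sup continuous_intros) auto
    then obtain y where y: "y \<in> {0..1}" "\<And>z. z \<in> {0..1} \<Longrightarrow> \<bar>u z\<bar> \<le> \<bar>u y\<bar>" by blast
    define m where "m = \<bar>u y\<bar>"
    have b0: "0 \<le> b" using b[of 0] by simp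
    have m: "m > 0" "real (Suc n) * b < m"
      using x y(2)[OF x(1)] b0 mult_nonneg_nonneg[of "real (Suc n)" b] unfolding m_def by linarith+
    \<comment> \<open>Division by the maximum of \<open>\<bar>u\<bar>\<close> gives \<open>v\<close>
      the maximum 1, attained at \<open>y\<close>, and makes the defect at most
      \<open>b / m\<close>, which is below \<open>1 / real (Suc n)\<close>.\<close>
    define v where "v = (\<lambda>x. (1 / m) * u x)"
    have "continuous_on {0..1} v"
      unfolding v_def by (rule continuous_on_mult[OF continuous_on_const u(1)])
    moreover have "L2ip (\<lambda>x. 1) v = 0"
      unfolding v_def by (simp only: L2ip_cmult_right u)
    moreover have "\<bar>v z\<bar> \<le> 1" if "z \<in> {0..1}" for z
      using y(2)[OF that] m by (simp add: v_def m_def[symmetric])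
    moreover have "\<bar>v z - T v z\<bar> \<le> 1 / real (Suc n)" if "z \<in> {0..1}" for z
    proof -
      have "v z - T v z = (1 / m) * (u z - T u z)"
        unfolding v_def T_cmult by (simp add: right_diff_distrib)
      then have "\<bar>v z - T v z\<bar> = \<bar>u z - T u z\<bar> / m"
        using m by (simp add: abs_mult)
      also have "\<dots> \<le> b / m"
        using b[OF that] m by (intro divide_right_mono) auto
      also have "\<dots> \<le> 1 / real (Suc n)"
        using m by (simp add: field_simps)
      finally show ?thesis .
    qed
    moreover have "\<bar>v y\<bar> = 1"
      using m by (simp add: v_def abs_mult m_def)
    ultimately show ?thesis using y(1) by blast
  qed
  then obtain v y where v: "\<And>n. continuous_on {0..1} (v n)" "\<And>n. L2ip (\<lambda>x. 1) (v n) = 0"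
    and v1: "\<And>n x. x \<in> {0..1} \<Longrightarrow> \<bar>v n x\<bar> \<le> 1"
    and vT: "\<And>n x. x \<in> {0..1} \<Longrightarrow> \<bar>v n x - T (v n) x\<bar> \<le> 1 / real (Suc n)"
    and y: "\<And>n. y n \<in> {0..1}" "\<And>n. \<bar>v n (y n)\<bar> = 1"
    by metis
  have vL: "v n \<in> L2" for n by (rule L2_continuous[OF v(1)])
  have vn: "L2norm (v n) \<le> 1" for n by (rule L2norm_bounded[OF L2_measurable[OF vL] v1])
  obtain g k where g: "continuous_on {0..1} g" and k: "strict_mono (k :: nat \<Rightarrow> nat)"
    and lim: "\<And>e. 0 < e \<Longrightarrow> \<exists>N. \<forall>n x. n \<ge> N \<and> x \<in> {0..1} \<longrightarrow> norm (T (v (k n)) x - g x) < e"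
  proof (rule Arzela_Ascoli[of "{0..1::real}" "\<lambda>n. T (v n)" "2 * CN"])
    show "norm (T (v n) x) \<le> 2 * CN" if "x \<in> {0..1}" for n x
    proof -
      have "\<bar>T (v n) x\<bar> \<le> 2 * CN * L2norm (v n)" by (rule T_bound[OF vL that])
      also have "\<dots> \<le> 2 * CN * 1" using CN_nonneg vn by (intro mult_left_mono) auto
      finally show ?thesis by simp
    qed
    show "\<exists>d>0. \<forall>n y. y \<in> {0..1} \<and> norm (x - y) < d \<longrightarrow> norm (T (v n) x - T (v n) y) < e"
      if "x \<in> {0..1}" "0 < e" for x e
    \<comment> \<open>The \<open>+ 1\<close> keeps the radius positive when
      \<open>CN = 0\<close>.\<close>
    proof (intro exI[of _ "e / (CN + 1)"] conjI allI impI)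
      show "0 < e / (CN + 1)" using that CN_nonneg by simp
      fix n y assume y: "y \<in> {0..1} \<and> norm (x - y) < e / (CN + 1)"
      have "\<bar>T (v n) x - T (v n) y\<bar> \<le> CN * L2norm (v n) * \<bar>x - y\<bar>"
        using y by (intro T_Lipschitz vL that) auto
      also have "\<dots> \<le> (CN + 1) * 1 * \<bar>x - y\<bar>"
        using CN_nonneg vn by (intro mult_right_mono mult_mono) auto
      also have "\<dots> < e"
        using y CN_nonneg by (simp add: field_simps)
      finally show "norm (T (v n) x - T (v n) y) < e" by simp
    qed
  qed auto
  have gL: "g \<in> L2" by (rule L2_continuous[OF g])
  have close: "\<exists>n. \<forall>x\<in>{0..1}. \<bar>T (v n) x - g x\<bar> \<le> e \<and> \<bar>v n x - g x\<bar> \<le> e" if "0 < e" for e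
  proof -
    obtain M where M: "\<And>n x. n \<ge> M \<Longrightarrow> x \<in> {0..1} \<Longrightarrow> \<bar>T (v (k n)) x - g x\<bar> < e / 2"
      using lim[of "e / 2"] \<open>0 < e\<close> unfolding real_norm_def by (meson half_gt_zero)
    obtain j :: nat where j: "2 / e < real j" using reals_Archimedean2 by blast
    define n where "n = max M j"
    have "j \<le> k n" using seq_suble[OF k, of n] by (simp add: n_def)
    then have "2 / e < real (Suc (k n))" using j by linarith
    then have "1 / real (Suc (k n)) < e / 2" using that by (simp add: field_simps)
    then have "\<bar>T (v (k n)) x - g x\<bar> \<le> e \<and> \<bar>v (k n) x - g x\<bar> \<le> e" if "x \<in> {0..1}" for x
    proof -
      have "M \<le> n" by (simp add: n_def)
      from M[OF this that] vT[OF that, of "k n"] \<open>1 / real (Suc (k n)) < e / 2\<close> \<open>0 < e\<close>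
      show ?thesis by linarith
    qed
    then show ?thesis by blast
  qed
  have zero: "a = 0" if "\<And>e. 0 < e \<Longrightarrow> \<bar>a\<bar> \<le> c * e" "0 \<le> c" for a c :: real
  proof (rule ccontr)
    assume "a \<noteq> 0"
    then have "\<bar>a\<bar> \<le> c * (\<bar>a\<bar> / (c + 1) / 2)" using that by (intro that(1)) simp
    also have "\<dots> = (c / (c + 1)) * (\<bar>a\<bar> / 2)" by simp
    also have "\<dots> \<le> 1 * (\<bar>a\<bar> / 2)" using that(2) by (intro mult_right_mono) auto
    finally show False using \<open>a \<noteq> 0\<close> by simp
  qed
  have dn: "L2norm (\<lambda>x. v n x - g x) \<le> e" if "\<And>x. x \<in> {0..1} \<Longrightarrow> \<bar>v n x - g x\<bar> \<le> e" for n e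
    by (rule L2norm_bounded[OF L2_measurable[OF L2_diff[OF vL gL]] that])
  have "L2ip (\<lambda>x. 1) g = 0"
  proof (rule zero[where c=1])
    fix e :: real assume "0 < e"
    then obtain n where n: "\<And>x. x \<in> {0..1} \<Longrightarrow> \<bar>v n x - g x\<bar> \<le> e" using close by blast
    have "\<bar>L2ip (\<lambda>x. 1) (\<lambda>x. v n x - g x)\<bar> \<le> 1 * e"
      using L2_Cauchy_Schwarz[OF L2_const L2_diff[OF vL gL], of 1 n] dn[OF n] by (simp add: L2norm_const)
    then show "\<bar>L2ip (\<lambda>x. 1) g\<bar> \<le> 1 * e"
      by (simp add: L2ip_diff_right[OF vL gL L2_const] v)
  qed simp
  moreover have "g x = T g x" if x: "x \<in> {0..1}" for x
  proof -
    have "T g x - g x = 0"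
    proof (rule zero[where c="2 * CN + 1"])
      fix e :: real assume "0 < e"
      then obtain n where n: "\<And>x. x \<in> {0..1} \<Longrightarrow> \<bar>v n x - g x\<bar> \<le> e"
        and Tn: "\<And>x. x \<in> {0..1} \<Longrightarrow> \<bar>T (v n) x - g x\<bar> \<le> e" using close by blast
      have "\<bar>T (v n) x - T g x\<bar> \<le> 2 * CN * L2norm (\<lambda>x. v n x - g x)"
        unfolding T_diff[OF vL gL, symmetric] by (rule T_bound[OF L2_diff[OF vL gL] x])
      also have "\<dots> \<le> 2 * CN * e" using CN_nonneg dn[OF n] by (intro mult_left_mono) auto
      finally show "\<bar>T g x - g x\<bar> \<le> (2 * CN + 1) * e" using Tn[OF x] by (simp add: algebra_simps)
    qed (use CN_nonneg in simp)
    then show ?thesis by simp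
  qed
  ultimately have g0: "g x = 0" if "x \<in> {0..1}" for x
    using kernel_trivial[OF gL _ _ that] by blast
  \<comment> \<open>The maximum points \<open>y n\<close> need not converge: closeness at the single
    point \<open>y n\<close>, where \<open>v n\<close> has modulus 1, already contradicts
    \<open>g = 0\<close>.\<close>
  obtain n where "\<And>x. x \<in> {0..1} \<Longrightarrow> \<bar>v n x - g x\<bar> \<le> 1 / 2" using close[of "1/2"]
    by (meson half_gt_zero zero_less_one)
  from this[OF y(1)[of n]] show False using y(2)[of n] g0[OF y(1)[of n]] by simp
qed

end

section \<open>Regularity of the weak solution\<close>

lemma H1_increment:
  assumes f: "f \<in> H1" and "0 \<le> z" "z \<le> y" "y \<le> 1"
  shows "\<bar>f y - f z\<bar> \<le> L2ip (indicator {z..y}) (\<lambda>x. \<bar>wd f x\<bar>)"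
proof -
  have "f y - f z = prim (wd f) y - prim (wd f) z"
    using H1_eq_prim[OF f, of y] H1_eq_prim[OF f, of z] assms(2-4) by simp
  then show ?thesis using prim_diff_abs[OF wd_L2[OF f] assms(2,3)] by simp
qed

context fractional_form
begin

text \<open>A product rule for increments. Domination by the integral of an \<open>L2\<close>
  function stands in for a weak derivative of \<open>N u\<close>: such bounds simply add up, and the
  derivative of the fractional integral need not be identified.\<close>

lemma N_increment:
  assumes u: "u \<in> L2" and zy: "0 \<le> z" "z \<le> y" "y \<le> 1"
    and B: "\<And>x. x \<in> {0..1} \<Longrightarrow> \<bar>u x\<bar> \<le> B"
    and L: "0 \<le> L" "\<And>x y. x \<in> {0..1} \<Longrightarrow> y \<in> {0..1} \<Longrightarrow> \<bar>u x - u y\<bar> \<le> L * \<bar>x - y\<bar>"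
  shows "\<bar>N u y - N u z\<bar> \<le> L2ip (indicator {z..y})
      (\<lambda>s. 2 * H1norm q * (L * ck \<alpha> + B * sk \<alpha> s) + ck \<alpha> * B * \<bar>wd q s\<bar> + ck \<alpha> * B * \<bar>wd p s\<bar>)"
    (is "_ \<le> L2ip ?I _")
proof -
  have mem: "y \<in> {0..1}" "z \<in> {0..1}" "1 \<in> {0..1::real}" using zy by auto
  have R: "\<bar>R u x\<bar> \<le> ck \<alpha> * B" if "x \<in> {0..1}" for x
  proof -
    have "\<bar>R u x\<bar> \<le> ck \<alpha> * L2norm u" by (rule Rop_bound[OF alpha(1) u that])
    also have "\<dots> \<le> ck \<alpha> * B"
      by (intro mult_left_mono ck_nonneg alpha L2norm_bounded[OF L2_measurable[OF u] B])
    finally show ?thesis .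
  qed
  have cB: "0 \<le> ck \<alpha> * B" using R[OF mem(3)] by simp
  note qp = H1_sup_bound[OF q_H1 mem(1)] H1_increment[OF q_H1 zy] H1_increment[OF p_H1 zy]
  have Q: "0 \<le> 2 * H1norm q" using qp(1) by simp
  define X where "X = L2ip ?I (\<lambda>s. L * ck \<alpha> + B * sk \<alpha> s)"
  define Y where "Y = L2ip ?I (\<lambda>x. \<bar>wd q x\<bar>)"
  define Z where "Z = L2ip ?I (\<lambda>x. \<bar>wd p x\<bar>)"
  have "N u y - N u z = q y * (R u y - R u z) + (q y - q z) * R u z + R u 1 * (p y - p z)"
    by (simp add: N_def algebra_simps)
  also have "\<bar>\<dots>\<bar> \<le> \<bar>q y * (R u y - R u z)\<bar> + \<bar>(q y - q z) * R u z\<bar> + \<bar>R u 1 * (p y - p z)\<bar>"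
    by linarith
  also have "\<dots> = \<bar>q y\<bar> * \<bar>R u y - R u z\<bar> + \<bar>R u z\<bar> * \<bar>q y - q z\<bar> + \<bar>R u 1\<bar> * \<bar>p y - p z\<bar>"
    by (simp add: abs_mult)
  also have "\<dots> \<le> 2 * H1norm q * X + ck \<alpha> * B * Y + ck \<alpha> * B * Z"
    unfolding X_def Y_def Z_def
    by (intro add_mono mult_mono qp R mem cB Q Rop_increment[OF alpha(1) u zy B L]) auto
  also have "\<dots> = L2ip ?I
      (\<lambda>s. 2 * H1norm q * (L * ck \<alpha> + B * sk \<alpha> s) + ck \<alpha> * B * \<bar>wd q s\<bar> + ck \<alpha> * B * \<bar>wd p s\<bar>)"
  proof -
    have 1: "(\<lambda>s. 2 * H1norm q * (L * ck \<alpha> + B * sk \<alpha> s)) \<in> L2"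
      by (rule L2_cmult[OF L2_add[OF L2_const L2_cmult[OF sk_L2[OF alpha(1)]]]])
    have 2: "(\<lambda>s. ck \<alpha> * B * \<bar>wd q s\<bar>) \<in> L2" by (rule L2_cmult[OF L2_abs[OF wd_L2[OF q_H1]]])
    have 3: "(\<lambda>s. ck \<alpha> * B * \<bar>wd p s\<bar>) \<in> L2" by (rule L2_cmult[OF L2_abs[OF wd_L2[OF p_H1]]])
    show ?thesis
      using L2ip_add_right[OF L2_add[OF 1 2] 3 L2_indicator, of z y] L2ip_add_right[OF 1 2 L2_indicator, of z y]
        L2ip_cmult_right[of ?I "2 * H1norm q" "\<lambda>s. L * ck \<alpha> + B * sk \<alpha> s"]
        L2ip_cmult_right[of ?I "ck \<alpha> * B" "\<lambda>s. \<bar>wd q s\<bar>"]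
        L2ip_cmult_right[of ?I "ck \<alpha> * B" "\<lambda>s. \<bar>wd p s\<bar>"]
      unfolding X_def Y_def Z_def by linarith
  qed
  finally show ?thesis .
qed

text \<open>Integrating the load by parts shows that \<open>wd w - T (wd w)\<close> plus the
  mean-free primitive of \<open>f\<close> is orthogonal to all derivatives of \<open>H10\<close>
  functions; having mean zero, it vanishes. As \<open>T\<close> ignores null sets, the equation then
  holds for the continuous \<open>u\<close> alone.\<close>

lemma weak_solution_derivative:
  assumes f: "f \<in> L2" and w: "w \<in> H10" and sol: "\<And>\<phi>. \<phi> \<in> H10 \<Longrightarrow> Aform \<alpha> q p w \<phi> = L2ip f \<phi>"
  obtains u where "u \<in> L2" "continuous_on {0..1} u" "AE x in UI. wd w x = u x" "L2ip (\<lambda>x. 1) u = 0"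
    "\<And>x. u x = T u x - (prim f x - L2ip (\<lambda>x. 1) (prim f))"
proof -
  define F where "F x = prim f x - L2ip (\<lambda>x. 1) (prim f)" for x
  define u where "u x = T (wd w) x - F x" for x
  note W = wd_L2[OF H10_imp_H1[OF w]]
  have F: "F \<in> L2" unfolding F_def[abs_def] by (rule L2_diff[OF prim_L2[OF f] L2_const])
  have Fm: "L2ip (\<lambda>x. 1) F = 0"
    unfolding F_def[abs_def] L2ip_diff_right[OF prim_L2[OF f] L2_const L2_const] by (simp add: L2ip_UI)
  have Fc: "continuous_on {0..1} F"
    unfolding F_def[abs_def] by (rule continuous_on_diff[OF prim_continuous[OF f] continuous_on_const])
  have uc: "continuous_on {0..1} u"
    unfolding u_def[abs_def] by (rule continuous_on_diff[OF T_continuous[OF W] Fc])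
  then have u: "u \<in> L2" by (rule L2_continuous)
  have um: "L2ip (\<lambda>x. 1) u = 0"
    unfolding u_def[abs_def] L2ip_diff_right[OF T_L2[OF W] F L2_const] by (simp add: T_mean[OF W] Fm)
  have "AE x in UI. wd w x - u x = 0"
  proof (rule orthogonal_H10_imp_AE[OF L2_diff[OF W u]])
    show "L2ip (\<lambda>x. 1) (\<lambda>x. wd w x - u x) = 0"
      using H10_mean_zero[OF w] um
      by (simp add: L2ip_diff_right[OF W u L2_const] prim_1_L2ip)
    fix \<phi> assume phi: "\<phi> \<in> H10"
    note V = wd_L2[OF H10_imp_H1[OF phi]]
    have mz: "L2ip (\<lambda>x. c) (wd \<phi>) = 0" for c
      using H10_mean_zero[OF phi] L2ip_cmult_left[of c "\<lambda>x. 1" "wd \<phi>"] by (simp add: prim_1_L2ip)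
    have "L2ip f \<phi> = L2ip f (prim (wd \<phi>))"
      by (rule L2ip_cong[OF refl H10_eq_prim[OF phi]])
    also have "\<dots> = - L2ip (prim f) (wd \<phi>)"
      by (simp add: L2ip_prim[OF f V] H10_mean_zero[OF phi])
    also have "\<dots> = - L2ip F (wd \<phi>)"
      unfolding F_def[abs_def] L2ip_diff_left[OF prim_L2[OF f] L2_const V] by (simp add: mz)
    finally have "L2ip (\<lambda>x. wd w x - T (wd w) x) (wd \<phi>) = - L2ip F (wd \<phi>)"
      using sol[OF phi] by (simp add: Aform_eq[OF w phi])
    then show "L2ip (\<lambda>x. wd w x - u x) (wd \<phi>) = 0"
      using L2ip_add_left[OF L2_diff[OF W T_L2[OF W]] F V] by (simp add: u_def algebra_simps)
  qed
  then have ae: "AE x in UI. wd w x = u x" by simp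
  have "u x = T u x - (prim f x - L2ip (\<lambda>x. 1) (prim f))" for x
    using fun_cong[OF T_cong_AE[OF W u ae], of x] unfolding u_def F_def by simp
  then show thesis by (rule that[OF u uc ae um])
qed

end

context fractional_problem
begin

text \<open>Fixed once, so that \<open>Creg\<close>, \<open>Cgal\<close> and \<open>mesh0\<close>
  depend on \<open>\<alpha>\<close>, \<open>q\<close> and \<open>p\<close> only.\<close>

definition Cst :: real where
  "Cst = (SOME C. 0 \<le> C \<and> (\<forall>u b. continuous_on {0..1} u \<longrightarrow> L2ip (\<lambda>x. 1) u = 0 \<longrightarrow>
     (\<forall>x\<in>{0..1}. \<bar>u x - T u x\<bar> \<le> b) \<longrightarrow> (\<forall>x\<in>{0..1}. \<bar>u x\<bar> \<le> C * b)))"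

lemma Cst_nonneg: "0 \<le> Cst"
  and stability_bound: "\<lbrakk>continuous_on {0..1} u; L2ip (\<lambda>x. 1) u = 0;
    \<And>x. x \<in> {0..1} \<Longrightarrow> \<bar>u x - T u x\<bar> \<le> b; x \<in> {0..1}\<rbrakk> \<Longrightarrow> \<bar>u x\<bar> \<le> Cst * b"
  using someI_ex[OF stability, folded Cst_def] by blast+

text \<open>The first summand is the factor bounding \<open>H\<close> in \<open>regularity\<close>,
  the parenthesis the one bounding the norm of \<open>G\<close>; the sum serves for both.\<close>

definition Creg :: real where
  "Creg = (2 * Cst * CN + 2) +
    (2 * H1norm q * ((2 * Cst * CN + 2) * ck \<alpha> + 2 * Cst * ck \<alpha>) + ck \<alpha> * (2 * Cst) * H1norm q
      + ck \<alpha> * (2 * Cst) * H1norm p + 1)"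

text \<open>\<open>u\<close> and \<open>H\<close> are the first and second derivatives of
  \<open>w\<close>. Differentiating the integrated equation gives \<open>H = N u - f\<close>:
  stability controls its size, and the bounds on increments of \<open>N u\<close> and
  \<open>f\<close> add up to \<open>G\<close>.\<close>

lemma regularity:
  assumes f: "f \<in> H1" and w: "w \<in> H10" and sol: "\<And>\<phi>. \<phi> \<in> H10 \<Longrightarrow> Aform \<alpha> q p w \<phi> = L2ip f \<phi>"
  obtains u H G where "u \<in> L2" "H \<in> L2" "G \<in> L2" "AE x in UI. wd w x = u x"
    "\<And>x. x \<in> {0..1} \<Longrightarrow> u x = u 0 + prim H x" "\<And>x. x \<in> {0..1} \<Longrightarrow> \<bar>H x\<bar> \<le> Creg * H1norm f"
    "L2norm G \<le> Creg * H1norm f"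
    "\<And>z y. 0 \<le> z \<Longrightarrow> z \<le> y \<Longrightarrow> y \<le> 1 \<Longrightarrow> \<bar>H y - H z\<bar> \<le> L2ip (indicator {z..y}) G"
proof -
  define k where "k = 2 * Cst * CN + 2"
  define K where "K = 2 * H1norm q * (k * ck \<alpha> + 2 * Cst * ck \<alpha>) + ck \<alpha> * (2 * Cst) * H1norm q
    + ck \<alpha> * (2 * Cst) * H1norm p + 1"
  have kK: "Creg = k + K" by (simp add: Creg_def k_def K_def)
  note [simp] = ck_nonneg[OF alpha(1)]
  have [simp]: "0 \<le> H1norm g" for g by (simp add: H1norm_def L2ip_self_nonneg)
  have k0: "0 \<le> k" using Cst_nonneg CN_nonneg by (simp add: k_def)
  have K0: "0 \<le> K" using Cst_nonneg k0 by (simp add: K_def)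
  define F where "F = H1norm f"
  have F0: "0 \<le> F" by (simp add: F_def)
  note fL = H1_L2[OF f]
  obtain u where u: "u \<in> L2" "continuous_on {0..1} u" "AE x in UI. wd w x = u x" "L2ip (\<lambda>x. 1) u = 0"
    and ueq: "\<And>x. u x = T u x - (prim f x - L2ip (\<lambda>x. 1) (prim f))"
    by (rule weak_solution_derivative[OF fL w sol], assumption) (rule that)
  \<comment> \<open>Up to sign \<open>u - T u\<close> is the mean-free primitive of
    \<open>f\<close>, hence at most \<open>2 * F\<close>, and stability yields the bound
    \<open>B\<close> for \<open>u\<close>. \<open>L\<close> will bound \<open>H\<close> and so be a
    Lipschitz constant of \<open>u\<close>.\<close>
  define B where "B = Cst * (2 * F)"
  define L where "L = k * F"
  have B: "\<bar>u x\<bar> \<le> B" if "x \<in> {0..1}" for x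
    unfolding B_def
  proof (rule stability_bound[OF u(2,4) _ that])
    fix x :: real assume x: "x \<in> {0..1}"
    have 1: "\<bar>prim f x\<bar> \<le> F" if "x \<in> {0..1}" for x
      using prim_bound[OF fL that] L2norm_le_H1norm(1)[of f] by (simp add: F_def)
    have "\<bar>L2ip (\<lambda>x. 1) (prim f)\<bar> \<le> F"
      using L2_Cauchy_Schwarz[OF L2_const prim_L2[OF fL], of 1]
        L2norm_bounded[OF L2_measurable[OF prim_L2[OF fL]] 1] by (simp add: L2norm_const)
    then show "\<bar>u x - T u x\<bar> \<le> 2 * F" using ueq[of x] 1[OF x] by linarith
  qed
  have un: "L2norm u \<le> B" by (rule L2norm_bounded[OF L2_measurable[OF u(1)] B])
  define H where "H x = N u x - f x" for x
  have H: "H \<in> L2" unfolding H_def[abs_def] by (rule L2_diff[OF N_L2[OF u(1)] fL])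
  have Hb: "\<bar>H x\<bar> \<le> L" if "x \<in> {0..1}" for x
  proof -
    have "\<bar>N u x\<bar> \<le> CN * B"
      using N_bound[OF u(1) that] mult_left_mono[OF un CN_nonneg] by linarith
    \<comment> \<open>The summand 2 of \<open>k\<close> pays for the maximum of \<open>f\<close>,
      the other summand for \<open>N u\<close>.\<close>
    moreover have "CN * B + 2 * F = L" by (simp add: L_def k_def B_def algebra_simps)
    ultimately show ?thesis using H1_sup_bound[OF f that] unfolding H_def F_def by linarith
  qed
  have uH: "u x = u 0 + prim H x" for x
    using ueq[of x] ueq[of 0]
    unfolding H_def[abs_def] prim_diff[OF N_L2[OF u(1)] fL] T_def prim_0 by simp
  have uL: "\<bar>u x - u y\<bar> \<le> L * \<bar>x - y\<bar>" if "x \<in> {0..1}" "y \<in> {0..1}" for x y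
    using prim_diff_bound[OF H that Hb] uH[of x] uH[of y] by simp
  have L0: "0 \<le> L" using k0 F0 by (simp add: L_def)
  have B0: "0 \<le> B" using Cst_nonneg F0 by (simp add: B_def)
  define G1 where "G1 s = 2 * H1norm q * (L * ck \<alpha> + B * sk \<alpha> s)" for s
  define G2 where "G2 s = ck \<alpha> * B * \<bar>wd q s\<bar>" for s
  define G3 where "G3 s = ck \<alpha> * B * \<bar>wd p s\<bar>" for s
  define G4 where "G4 s = \<bar>wd f s\<bar>" for s
  define G where "G s = G1 s + G2 s + G3 s + G4 s" for s
  have sk: "(\<lambda>s. L * ck \<alpha> + B * sk \<alpha> s) \<in> L2"
    by (rule L2_add[OF L2_const L2_cmult[OF sk_L2[OF alpha(1)]]])
  have G1: "G1 \<in> L2" unfolding G1_def[abs_def] by (rule L2_cmult[OF sk])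
  have G2: "G2 \<in> L2" unfolding G2_def[abs_def] by (rule L2_cmult[OF L2_abs[OF wd_L2[OF q_H1]]])
  have G3: "G3 \<in> L2" unfolding G3_def[abs_def] by (rule L2_cmult[OF L2_abs[OF wd_L2[OF p_H1]]])
  have G4: "G4 \<in> L2" unfolding G4_def[abs_def] by (rule L2_abs[OF wd_L2[OF f]])
  note G12 = L2_add[OF G1 G2]
  note G123 = L2_add[OF G12 G3]
  have G: "G \<in> L2" unfolding G_def[abs_def] by (rule L2_add[OF G123 G4])
  have Hinc: "\<bar>H y - H z\<bar> \<le> L2ip (indicator {z..y}) G" if "0 \<le> z" "z \<le> y" "y \<le> 1" for z y
  proof -
    have "\<bar>N u y - N u z\<bar> \<le> L2ip (indicator {z..y}) (\<lambda>s. G1 s + G2 s + G3 s)"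
      unfolding G1_def G2_def G3_def by (rule N_increment[OF u(1) that B L0 uL])
    moreover have "\<bar>f y - f z\<bar> \<le> L2ip (indicator {z..y}) G4"
      unfolding G4_def[abs_def] by (rule H1_increment[OF f that])
    moreover have "L2ip (indicator {z..y}) G =
        L2ip (indicator {z..y}) (\<lambda>s. G1 s + G2 s + G3 s) + L2ip (indicator {z..y}) G4"
      unfolding G_def[abs_def] by (rule L2ip_add_right[OF G123 G4 L2_indicator])
    ultimately show ?thesis unfolding H_def by linarith
  qed
  have "L2norm (\<lambda>s. \<bar>g s\<bar>) = L2norm g" for g
    by (simp add: L2norm_def L2ip_def)
  note abs_norm = this
  have "L2norm G \<le> L2norm G1 + L2norm G2 + L2norm G3 + L2norm G4"
    using L2norm_triangle[OF G123 G4] L2norm_triangle[OF G12 G3] L2norm_triangle[OF G1 G2]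
    unfolding G_def[abs_def] by linarith
  also have "L2norm G1 \<le> 2 * H1norm q * (L * ck \<alpha> + B * ck \<alpha>)"
  proof -
    have "L2norm (\<lambda>s. L * ck \<alpha> + B * sk \<alpha> s) \<le> \<bar>L * ck \<alpha>\<bar> + \<bar>B\<bar> * L2norm (sk \<alpha>)"
      using L2norm_triangle[OF L2_const L2_cmult[OF sk_L2[OF alpha(1)]], of "L * ck \<alpha>" B]
      by (simp only: L2norm_const L2norm_cmult)
    also have "\<dots> \<le> L * ck \<alpha> + B * ck \<alpha>"
      using L0 B0 sk_norm[OF alpha(1)] by (simp add: abs_mult mult_left_mono)
    finally show ?thesis
      unfolding G1_def[abs_def] L2norm_cmult by (simp add: abs_mult mult_left_mono)
  qed
  also have "L2norm G2 \<le> ck \<alpha> * B * H1norm q"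
    unfolding G2_def[abs_def] L2norm_cmult abs_norm
    using B0 L2norm_le_H1norm(2)[of q] by (simp add: abs_mult mult_left_mono)
  also have "L2norm G3 \<le> ck \<alpha> * B * H1norm p"
    unfolding G3_def[abs_def] L2norm_cmult abs_norm
    using B0 L2norm_le_H1norm(2)[of p] by (simp add: abs_mult mult_left_mono)
  also have "L2norm G4 \<le> F"
    unfolding G4_def[abs_def] abs_norm F_def by (rule L2norm_le_H1norm)
  also have "2 * H1norm q * (L * ck \<alpha> + B * ck \<alpha>) + ck \<alpha> * B * H1norm q + ck \<alpha> * B * H1norm p + F = K * F"
    by (simp add: K_def L_def B_def algebra_simps)
  finally have Gn: "L2norm G \<le> K * F" by simp
  have LK: "L \<le> Creg * F" "K * F \<le> Creg * F"
    using k0 K0 F0 by (auto simp: L_def kK intro!: mult_right_mono)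
  have Hb': "\<bar>H x\<bar> \<le> Creg * H1norm f" if "x \<in> {0..1}" for x
    using Hb[OF that] LK(1) unfolding F_def by linarith
  have Gn': "L2norm G \<le> Creg * H1norm f"
    using Gn LK(2) unfolding F_def by linarith
  show thesis by (rule that[OF u(1) H G u(3) uH Hb' Gn' Hinc])
qed

end

section \<open>Piecewise polynomials\<close>

lemma poly_antiderivative:
  fixes P :: "real poly"
  obtains Q where "pderiv Q = P" "degree Q \<le> degree P + 1"
proof
  define Q where "Q = (\<Sum>i\<le>degree P. monom (coeff P i / real (Suc i)) (Suc i))"
  have "pderiv Q = (\<Sum>i\<le>degree P. monom (coeff P i) i)"
    unfolding Q_def using higher_pderiv_sum[of 1 "\<lambda>i. monom (coeff P i / real (Suc i)) (Suc i)" "{..degree P}"]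
    by (simp add: pderiv_monom del: of_nat_Suc)
  then show "pderiv Q = P" by (simp add: poly_as_sum_of_monoms)
  show "degree Q \<le> degree P + 1"
    unfolding Q_def by (intro degree_sum_le) (auto intro: order_trans[OF degree_monom_le])
qed

locale partition =
  fixes n :: nat and x :: "nat \<Rightarrow> real"
  assumes part: "is_partition n x"
begin

abbreviation h :: real where "h \<equiv> mesh n x"

lemma x_0: "x 0 = 0" and x_n: "x n = 1" and n_pos: "0 < n"
  using part by (auto simp: is_partition_def)

lemma x_mono: "i \<le> j \<Longrightarrow> j \<le> n \<Longrightarrow> x i \<le> x j"
proof (induction rule: dec_induct)
  case (step m)
  then have "x m < x (Suc m)" using part by (auto simp: is_partition_def)
  with step show ?case by simp
qed simp

lemma x_in: "i \<le> n \<Longrightarrow> x i \<in> {0..1}"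
  using x_mono[of 0 i] x_mono[of i n] by (simp add: x_0 x_n)

lemma step_le_mesh: "i < n \<Longrightarrow> x (Suc i) - x i \<le> h"
  unfolding mesh_def by (intro Max_ge) auto

lemma step_pos: "i < n \<Longrightarrow> x i < x (Suc i)"
  using part by (auto simp: is_partition_def)

lemma mesh_pos: "0 < h"
  using step_le_mesh[OF n_pos] step_pos[OF n_pos] by simp

lemma mesh_le_1: "h \<le> 1"
  unfolding mesh_def
proof (intro Max.boundedI)
  show "d \<le> 1" if "d \<in> (\<lambda>i. x (Suc i) - x i) ` {..<n}" for d
  proof -
    obtain i where i: "i < n" "d = x (Suc i) - x i" using \<open>d \<in> _\<close> by auto
    have "x i \<in> {0..1}" "x (Suc i) \<in> {0..1}" using i(1) by (auto intro!: x_in simp del: atLeastAtMost_iff)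
    then show ?thesis using i(2) by simp
  qed
qed (use n_pos in auto)

text \<open>Nodes belong to the cell on their left, except for \<open>x 0\<close>. Outside of \<open>{0..1}\<close> the value is arbitrary.\<close>

definition idx :: "real \<Rightarrow> nat" where
  "idx t = (LEAST i. t \<le> x (Suc i))"

lemma idx_props:
  assumes "t \<in> {0..1}"
  shows idx_less: "idx t < n" and idx_upper: "t \<le> x (Suc (idx t))" and idx_lower: "x (idx t) \<le> t"
proof -
  have "t \<le> x (Suc (n - 1))" using assms n_pos x_n by simp
  then show *: "t \<le> x (Suc (idx t))" unfolding idx_def by (rule LeastI)
  have "idx t \<le> n - 1" unfolding idx_def by (rule Least_le) fact
  then show "idx t < n" using n_pos by simp
  show "x (idx t) \<le> t"
  proof (cases "idx t")
    case 0
    then show ?thesis using assms x_0 by simp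
  next
    case (Suc j)
    then have "\<not> t \<le> x (Suc j)" unfolding idx_def using not_less_Least by (metis lessI)
    then show ?thesis using Suc by simp
  qed
qed

lemma idx_eq:
  assumes "i < n" "x i < t" "t \<le> x (Suc i)"
  shows "idx t = i"
proof -
  have "idx t \<le> i" unfolding idx_def by (rule Least_le) fact
  moreover have "i \<le> idx t"
  proof (rule ccontr)
    assume "\<not> i \<le> idx t"
    then have "Suc (idx t) \<le> i" by simp
    then have "x (Suc (idx t)) \<le> x i" using assms by (intro x_mono) auto
    moreover have "t \<in> {0..1}"
      using assms x_in[of i] x_in[of "Suc i"] by auto
    ultimately show False using idx_upper[of t] assms by auto
  qed
  ultimately show ?thesis by simp
qed

text \<open>The level sets of \<open>idx\<close> for \<open>i < n\<close>. Only the first is closed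
  on the left, so that they are disjoint and cover the unit interval.\<close>

definition cell :: "nat \<Rightarrow> real set" where
  "cell i = (if i = 0 then {0..x 1} else {x i<..x (Suc i)})"

lemma idx_eq_iff:
  assumes "t \<in> {0..1}" "i < n"
  shows "idx t = i \<longleftrightarrow> t \<in> cell i"
proof
  assume *: "idx t = i"
  show "t \<in> cell i"
  proof (cases i)
    case 0
    then show ?thesis using * assms idx_upper[of t] by (simp add: cell_def)
  next
    case (Suc j)
    then have "\<not> t \<le> x (Suc j)" using * unfolding idx_def using not_less_Least by (metis lessI)
    then show ?thesis using * Suc assms idx_upper[of t] by (simp add: cell_def)
  qed
next
  assume t: "t \<in> cell i"
  show "idx t = i"
  proof (cases "i = 0")
    case True
    then have "t \<le> x (Suc 0)" using t by (simp add: cell_def)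
    then have "idx t \<le> 0" unfolding idx_def by (intro Least_le)
    then show ?thesis using True by simp
  next
    case False
    then show ?thesis using t assms by (intro idx_eq) (auto simp: cell_def)
  qed
qed

lemma cell_measurable [measurable]: "cell i \<in> sets borel"
  by (auto simp: cell_def)

lemma idx_sum:
  assumes "t \<in> {0..1}"
  shows "(\<Sum>i<n. indicator (cell i) t * f i) = (f (idx t) :: real)"
proof -
  have "(\<Sum>i<n. indicator (cell i) t * f i) = (\<Sum>i<n. if i = idx t then f i else 0)"
    using idx_eq_iff[OF assms] by (intro sum.cong) (auto simp: indicator_def)
  also have "\<dots> = f (idx t)" using idx_less[OF assms] by simp
  finally show ?thesis .
qed

lemma cellwise_L2:
  assumes "\<And>i. continuous_on {0..1} (f i)"
  shows "(\<lambda>t. f (idx t) t) \<in> L2"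
proof -
  have "(\<lambda>t. \<Sum>i<n. indicator (cell i) t * f i t) \<in> L2"
    by (intro L2_sum L2_mult_bounded[where B=1] L2_continuous[OF assms] measurable_UI_borel)
       (auto simp: indicator_def)
  then show ?thesis
    by (rule L2_cong) (rule idx_sum)
qed

text \<open>Jumps at the nodes are allowed, as for derivatives of finite element functions. The
  polynomials use the global variable, so sums and shifts by constants can be done on the
  coefficients.\<close>

definition pwp :: "(nat \<Rightarrow> real poly) \<Rightarrow> real \<Rightarrow> real" where
  "pwp P t = poly (P (idx t)) t"

lemma pwp_L2: "pwp P \<in> L2"
  unfolding pwp_def[abs_def] by (rule cellwise_L2) (intro continuous_intros)

lemma prim_pwp:
  assumes i: "i < n" and y: "x i \<le> y" "y \<le> x (Suc i)" and Q: "pderiv Q = P i"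
  shows "prim (pwp P) y - prim (pwp P) (x i) = poly Q y - poly Q (x i)"
proof -
  have xi: "0 \<le> x i" "x (Suc i) \<le> 1" using x_in[of i] x_in[of "Suc i"] i by auto
  have PL: "poly (P i) \<in> L2" by (rule L2_continuous) (intro continuous_intros)
  have "prim (pwp P) y - prim (pwp P) (x i) = (\<integral>t. indicator {x i..y} t * pwp P t \<partial>UI)"
    using prim_diff_eq[OF pwp_L2 xi(1) y(1)] by (simp add: L2ip_UI)
  also have "\<dots> = (\<integral>t. indicator {x i..y} t * poly (P i) t \<partial>UI)"
  proof (rule integral_cong_AE)
    \<comment> \<open>Unless \<open>i = 0\<close>, the node \<open>x i\<close> belongs to the
      previous cell, so the integrands may differ at this one point.\<close>
    show "AE t in UI. indicator {x i..y} t * pwp P t = indicator {x i..y} t * poly (P i) t"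
      using AE_UI_neq[of "x i"]
    proof eventually_elim
      case (elim t)
      then show ?case
        using idx_eq[OF i, of t] y by (cases "t \<in> {x i..y}") (auto simp: pwp_def)
    qed
  qed (auto intro!: L2_measurable L2_indicator_mult pwp_L2 PL)
  also have "\<dots> = (\<integral>t. poly (P i) t * indicator {x i..y} t \<partial>lborel)"
    unfolding integral_UI set_lebesgue_integral_def
    by (rule Bochner_Integration.integral_cong) (use xi y in \<open>auto simp: indicator_def\<close>)
  also have "\<dots> = poly Q y - poly Q (x i)"
    using poly_DERIV[of Q] unfolding Q by (intro integral_FTC_Icc_real y(1)) auto
  finally show ?thesis .
qed

text \<open>Together with \<open>FE_derivative\<close> this identifies the derivatives of finite
  element functions with the mean-zero piecewise polynomials of degree at most \<open>k\<close>;
  mean zero is the boundary condition at 1.\<close>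

lemma prim_pwp_FE:
  assumes "\<And>i. degree (P i) \<le> k" "prim (pwp P) 1 = 0"
  shows "prim (pwp P) \<in> FE_space k n x"
  unfolding FE_space_def
proof (intro CollectI conjI allI impI)
  show "continuous_on {0..1} (prim (pwp P))" by (rule prim_continuous[OF pwp_L2])
  show "prim (pwp P) 0 = 0" by (rule prim_0)
  fix i assume i: "i < n"
  obtain Q where Q: "pderiv Q = P i" "degree Q \<le> degree (P i) + 1" by (rule poly_antiderivative)
  show "\<exists>P'. degree P' \<le> k + 1 \<and> (\<forall>y\<in>{x i..x (Suc i)}. prim (pwp P) y = poly P' y)"
  proof (intro exI[of _ "Q + [:prim (pwp P) (x i) - poly Q (x i):]"] conjI ballI)
    show "degree (Q + [:prim (pwp P) (x i) - poly Q (x i):]) \<le> k + 1"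
      using Q(2) assms(1)[of i] by (intro degree_add_le) auto
    fix y assume "y \<in> {x i..x (Suc i)}"
    then show "prim (pwp P) y = poly (Q + [:prim (pwp P) (x i) - poly Q (x i):]) y"
      using prim_pwp[where P=P and Q=Q and i=i and y=y] i Q(1) by simp
  qed
qed (rule assms)

lemma FE_derivative:
  assumes "v \<in> FE_space k n x"
  obtains P where "\<And>i. degree (P i) \<le> k" "H1_rep v (pwp P)"
proof -
  have "\<forall>i. \<exists>V :: real poly. i < n \<longrightarrow> degree V \<le> k + 1 \<and> (\<forall>y\<in>{x i..x (Suc i)}. v y = poly V y)"
    using assms unfolding FE_space_def by blast
  then obtain V :: "nat \<Rightarrow> real poly" where V: "\<And>i. i < n \<Longrightarrow> degree (V i) \<le> k + 1"
    "\<And>i y. i < n \<Longrightarrow> y \<in> {x i..x (Suc i)} \<Longrightarrow> v y = poly (V i) y"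
    by metis
  \<comment> \<open>The degree bound is asserted for every index, hence the default 0 beyond the
    last cell.\<close>
  define P where "P i = (if i < n then pderiv (V i) else 0)" for i
  have inc: "v y - v (x i) = prim (pwp P) y - prim (pwp P) (x i)"
    if "i < n" "x i \<le> y" "y \<le> x (Suc i)" for i y
    using prim_pwp[OF that, where P=P and Q="V i"] V(2)[OF that(1), of y] V(2)[OF that(1), of "x i"] that
    by (simp add: P_def)
  have node: "v (x i) = v 0 + prim (pwp P) (x i)" if "i \<le> n" for i
    using that
  proof (induction i)
    case 0
    then show ?case by (simp add: x_0 prim_0)
  next
    case (Suc i)
    then show ?case using inc[of i "x (Suc i)"] step_pos[of i] by simp
  qed
  show thesis
  proof (rule that)
    show "degree (P i) \<le> k" for i
      using V(1)[of i] by (auto simp: P_def degree_pderiv)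
    show "H1_rep v (pwp P)"
      unfolding H1_rep_iff
    proof (intro conjI ballI pwp_L2)
      fix t :: real assume t: "t \<in> {0..1}"
      show "v t = v 0 + prim (pwp P) t"
        using inc[OF idx_props(1,3,2)[OF t]] node[of "idx t"] idx_less[OF t] by simp
    qed
  qed
qed

lemma FE_H10: "v \<in> FE_space k n x \<Longrightarrow> v \<in> H10"
  unfolding H10_def H1_def by (auto elim: FE_derivative) (auto simp: FE_space_def)

section \<open>Approximation by piecewise constants and piecewise linear functions\<close>

lemma approx_Lipschitz:
  assumes L: "0 \<le> L" "\<And>s t. s \<in> {0..1} \<Longrightarrow> t \<in> {0..1} \<Longrightarrow> \<bar>g s - g t\<bar> \<le> L * \<bar>s - t\<bar>"
    and g: "g \<in> L2"
  obtains P where "\<And>i. degree (P i) = 0" "L2norm (\<lambda>t. g t - pwp P t) \<le> L * h"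
proof (rule that[of "\<lambda>i. [:g (x i):]"])
  show "L2norm (\<lambda>t. g t - pwp (\<lambda>i. [:g (x i):]) t) \<le> L * h"
  proof (rule L2norm_bounded)
    show "(\<lambda>t. g t - pwp (\<lambda>i. [:g (x i):]) t) \<in> borel_measurable UI"
      by (rule L2_measurable[OF L2_diff[OF g pwp_L2]])
    fix t :: real assume t: "t \<in> {0..1}"
    note i = idx_props[OF t]
    have "\<bar>g t - g (x (idx t))\<bar> \<le> L * \<bar>t - x (idx t)\<bar>"
      using i by (intro L(2) t x_in) simp
    also have "\<dots> \<le> L * h"
      using i step_le_mesh[OF i(1)] L(1) by (intro mult_left_mono) auto
    finally show "\<bar>g t - pwp (\<lambda>i. [:g (x i):]) t\<bar> \<le> L * h" by (simp add: pwp_def)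
  qed
qed simp

lemma cell_AE: "i < n \<Longrightarrow> AE t in UI. (indicator {x i..x (Suc i)} t :: real) = indicator (cell i) t"
  using AE_UI_neq[of "x i"] by eventually_elim (auto simp: cell_def indicator_def x_0)

text \<open>Taylor expansion at the left node of each cell, with slope \<open>H (x i)\<close>.
  Cauchy-Schwarz bounds the increment of \<open>H\<close> on a cell by \<open>sqrt h\<close> times
  the local norm \<open>c i\<close> of \<open>G\<close>, and integrating it adds a factor
  \<open>h\<close>. The last \<open>sqrt h\<close> appears when the squares of the
  \<open>c i\<close>, weighted by the cell lengths, are summed.\<close>

lemma approx_linear:
  assumes H: "H \<in> L2" and G: "G \<in> L2" and u: "\<And>t. t \<in> {0..1} \<Longrightarrow> u t = u 0 + prim H t" and uL: "u \<in> L2"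
    and inc: "\<And>z y. 0 \<le> z \<Longrightarrow> z \<le> y \<Longrightarrow> y \<le> 1 \<Longrightarrow> \<bar>H y - H z\<bar> \<le> L2ip (indicator {z..y}) G"
  obtains P where "\<And>i. degree (P i) \<le> 1" "L2norm (\<lambda>t. u t - pwp P t) \<le> h\<^sup>2 * L2norm G"
proof (rule that[of "\<lambda>i. [:u (x i) - H (x i) * x i, H (x i):]"])
  define P where "P = (\<lambda>i. [:u (x i) - H (x i) * x i, H (x i):])"
  define I where "I i = {x i..x (Suc i)}" for i
  define c where "c i = L2norm (\<lambda>t. indicator (I i) t * G t)" for i
  have c0: "0 \<le> c i" for i by (simp add: c_def)
  have Hi: "\<bar>H s - H (x i)\<bar> \<le> sqrt h * c i" if "i < n" "s \<in> I i" for i s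
  proof -
    have s: "0 \<le> x i" "x i \<le> s" "s \<le> 1" "s \<le> x (Suc i)"
      using that x_in[of i] x_in[of "Suc i"] by (auto simp: I_def)
    have "\<bar>H s - H (x i)\<bar> \<le> L2ip (indicator {x i..s}) G" by (rule inc[OF s(1-3)])
    also have "L2ip (indicator {x i..s}) G = L2ip (indicator {x i..s}) (\<lambda>t. indicator (I i) t * G t)"
      unfolding L2ip_UI I_def
      by (rule Bochner_Integration.integral_cong) (use s in \<open>auto simp: indicator_def\<close>)
    also have "\<dots> \<le> L2norm (indicator {x i..s}) * c i"
      using L2_Cauchy_Schwarz[OF L2_indicator L2_indicator_mult[OF G], of "x i" s "x i" "x (Suc i)"]
      unfolding c_def I_def by linarith
    also have "\<dots> \<le> sqrt h * c i"
      using s step_le_mesh[OF that(1)] c0 by (intro mult_right_mono) (auto simp: L2norm_indicator)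
    finally show ?thesis .
  qed
  have pt: "\<bar>u t - pwp P t\<bar> \<le> h * sqrt h * c (idx t)" if t: "t \<in> {0..1}" for t
  proof -
    define i where "i = idx t"
    note i = idx_props[OF t, folded i_def]
    have xi: "x i \<in> {0..1}" using i by (intro x_in) simp
    then have xi0: "0 \<le> x i" by simp
    have D: "(\<lambda>s. H s - H (x i)) \<in> L2" by (rule L2_diff[OF H L2_const])
    have "prim (\<lambda>s. H (x i)) t - prim (\<lambda>s. H (x i)) (x i) = H (x i) * (t - x i)"
      using prim_diff_eq[OF L2_const, of "x i" t "H (x i)"] xi i t
      by (simp add: L2ip_UI Int_absorb2 UI_def measure_restrict_space)
    then have "u t - pwp P t = prim (\<lambda>s. H s - H (x i)) t - prim (\<lambda>s. H s - H (x i)) (x i)"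
      unfolding prim_diff[OF H L2_const] using u[OF t] u[OF xi]
      by (simp add: pwp_def P_def i_def[symmetric] algebra_simps)
    also have "\<bar>\<dots>\<bar> \<le> L2ip (indicator {x i..t}) (\<lambda>s. sqrt h * c i)"
      unfolding prim_diff_eq[OF D xi0 i(3)]
    proof -
      have "L2ip (indicator {x i..t}) (\<lambda>s. H s - H (x i)) =
          L2ip (indicator {x i..t}) (\<lambda>s. indicator {x i..t} s * (H s - H (x i)))"
        unfolding L2ip_UI by (rule Bochner_Integration.integral_cong) (auto simp: indicator_def)
      also have "\<bar>\<dots>\<bar> \<le> L2ip (indicator {x i..t}) (\<lambda>s. sqrt h * c i)"
      proof (rule L2ip_abs_le[OF L2_indicator L2_indicator_mult[OF D] L2_const])
        show "\<bar>indicator {x i..t} s * (H s - H (x i))\<bar> \<le> sqrt h * c i" for s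
          using Hi[OF i(1), of s] i(2) c0[of i] mesh_pos by (cases "s \<in> {x i..t}") (auto simp: I_def)
      qed simp
      finally show "\<bar>L2ip (indicator {x i..t}) (\<lambda>s. H s - H (x i))\<bar> \<le> L2ip (indicator {x i..t}) (\<lambda>s. sqrt h * c i)" .
    qed
    also have "\<dots> = sqrt h * c i * (t - x i)"
      using xi t i by (simp add: L2ip_UI Int_absorb2 UI_def measure_restrict_space)
    also have "\<dots> \<le> sqrt h * c i * h"
      using i step_le_mesh[OF i(1)] c0[of i] mesh_pos by (intro mult_left_mono) auto
    finally show ?thesis by (simp add: i_def mult_ac)
  qed
  have cL: "(\<lambda>t. c (idx t)) \<in> L2" by (rule cellwise_L2) simp
  have cell_int: "integral\<^sup>L UI (indicator (cell i)) = x (Suc i) - x i" if "i < n" for i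
  proof -
    have "integral\<^sup>L UI (indicator (cell i) :: real \<Rightarrow> real) = integral\<^sup>L UI (indicator (I i))"
      unfolding I_def using cell_AE[OF that]
      by (intro integral_cong_AE measurable_UI_borel) (auto elim!: eventually_mono)
    then show ?thesis
      using that x_in[of i] x_in[of "Suc i"] step_pos[OF that]
      by (simp add: I_def Int_absorb2 UI_def measure_restrict_space)
  qed
  have G2: "integrable UI (\<lambda>t. (G t)\<^sup>2)" using G by (simp add: L2_def)
  have cell_sets: "cell i \<inter> {0..1} \<in> sets UI" for i
    by (auto simp: sets_UI sets_restrict_space)
  have iG: "integrable UI (\<lambda>t. indicator (cell i) t * (G t)\<^sup>2)" for i
  proof (rule Bochner_Integration.integrable_bound[OF G2])
    show "(\<lambda>t. indicator (cell i) t * (G t)\<^sup>2) \<in> borel_measurable UI"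
      by (rule borel_measurable_times[OF measurable_UI_borel borel_measurable_integrable[OF G2]]) simp
  qed (auto simp: indicator_def)
  have c2: "(c i)\<^sup>2 = (\<integral>t. indicator (cell i) t * (G t)\<^sup>2 \<partial>UI)" if "i < n" for i
    unfolding c_def L2norm_square L2ip_UI
  proof (rule integral_cong_AE)
    show "AE t in UI. indicator (I i) t * G t * (indicator (I i) t * G t) = indicator (cell i) t * (G t)\<^sup>2"
      using cell_AE[OF that] by eventually_elim (auto simp: I_def indicator_def power2_eq_square)
    show "(\<lambda>t. indicator (I i) t * G t * (indicator (I i) t * G t)) \<in> borel_measurable UI"
      unfolding I_def by (intro borel_measurable_times L2_measurable[OF L2_indicator_mult[OF G]])
  qed (rule borel_measurable_integrable[OF iG])
  have "(L2norm (\<lambda>t. c (idx t)))\<^sup>2 = (\<integral>t. (\<Sum>i<n. indicator (cell i) t * (c i)\<^sup>2) \<partial>UI)"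
    unfolding L2norm_square L2ip_UI
    by (rule Bochner_Integration.integral_cong[OF refl])
       (subst idx_sum, auto simp: power2_eq_square)
  also have "\<dots> = (\<Sum>i<n. (c i)\<^sup>2 * (x (Suc i) - x i))"
    by (subst Bochner_Integration.integral_sum)
       (auto simp: cell_int[simplified] mult.commute intro!: sum.cong integrable_mult_left UI.integrable_const_bound[where B=1] measurable_UI_borel)
  also have "\<dots> \<le> (\<Sum>i<n. (c i)\<^sup>2 * h)"
    by (intro sum_mono mult_left_mono step_le_mesh) auto
  also have "\<dots> = h * (\<integral>t. (\<Sum>i<n. indicator (cell i) t * (G t)\<^sup>2) \<partial>UI)"
    by (subst Bochner_Integration.integral_sum) (auto simp: iG c2 sum_distrib_left mult.commute)
  also have "(\<integral>t. (\<Sum>i<n. indicator (cell i) t * (G t)\<^sup>2) \<partial>UI) = (L2norm G)\<^sup>2"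
    unfolding L2norm_square L2ip_UI
    by (rule Bochner_Integration.integral_cong[OF refl])
       (subst idx_sum, auto simp: power2_eq_square)
  finally have "(L2norm (\<lambda>t. c (idx t)))\<^sup>2 \<le> (sqrt h * L2norm G)\<^sup>2"
    using mesh_pos by (simp add: power_mult_distrib)
  then have cn: "L2norm (\<lambda>t. c (idx t)) \<le> sqrt h * L2norm G"
    by (rule power2_le_imp_le) (use mesh_pos in simp)
  have "L2norm (\<lambda>t. u t - pwp P t) \<le> L2norm (\<lambda>t. h * sqrt h * c (idx t))"
  proof (rule L2norm_mono[OF L2_cmult[OF cL] L2_measurable[OF L2_diff[OF uL pwp_L2]]])
    show "\<bar>u t - pwp P t\<bar> \<le> \<bar>h * sqrt h * c (idx t)\<bar>" if "t \<in> {0..1}" for t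
      using pt[OF that] by linarith
  qed
  also have "\<dots> = h * sqrt h * L2norm (\<lambda>t. c (idx t))"
    using mesh_pos by (simp add: L2norm_cmult abs_mult)
  also have "\<dots> \<le> h * sqrt h * (sqrt h * L2norm G)"
    using cn mesh_pos by (intro mult_left_mono) auto
  also have "\<dots> = h\<^sup>2 * L2norm G"
    using mesh_pos by (simp add: power2_eq_square)
  finally show "L2norm (\<lambda>t. u t - pwp (\<lambda>i. [:u (x i) - H (x i) * x i, H (x i):]) t) \<le> h\<^sup>2 * L2norm G"
    unfolding P_def .
qed simp

end

section \<open>Approximation of the kernel\<close>

text \<open>The first summand belongs to interpolation away from the singularity, the second to the
  discarded tail of length at most \<open>2 * h\<close>, where
  \<open>2 powr (\<alpha> - 3/2)\<close> is estimated by 2.\<close>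

definition ck3 :: "real \<Rightarrow> real" where
  "ck3 \<alpha> = 1 / Gamma (\<alpha> - 1) + 2 * ck \<alpha>"

lemma ck3_nonneg: "3/2 < \<alpha> \<Longrightarrow> 0 \<le> ck3 \<alpha>"
  by (auto simp: ck3_def intro!: add_nonneg_nonneg mult_nonneg_nonneg ck_nonneg
      divide_nonneg_pos Gamma_real_pos)

text \<open>\<open>D\<close> is \<open>h\<close> times the slope bound of
  \<open>kap_increment\<close>, cut off at distance \<open>h\<close> from the singularity. The
  integral of its squared power is dominated by that end and of order
  \<open>h powr (2 * \<alpha> - 5)\<close>, where \<open>\<alpha> < 2\<close> makes the denominator
  \<open>5 - 2 * \<alpha>\<close> at least 1; the factor \<open>h\<^sup>2\<close> completes the
  square of \<open>h powr (\<alpha> - 3/2)\<close>.\<close>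

lemma kap_smooth_part_norm:
  fixes \<alpha> y h :: real
  assumes a: "3/2 < \<alpha>" "\<alpha> < 2" and y: "y \<le> 1" and h: "0 < h"
  defines "D \<equiv> \<lambda>t. indicator {0..y - h} t * (h * (y - t) powr (\<alpha> - 3) / Gamma (\<alpha> - 1))"
  shows "D \<in> L2" "L2norm D \<le> 1 / Gamma (\<alpha> - 1) * h powr (\<alpha> - 3/2)"
proof -
  define G where "G = Gamma (\<alpha> - 1)"
  have G: "0 < G" using a by (auto simp: G_def intro!: Gamma_real_pos)
  have m: "D \<in> borel_measurable UI" unfolding D_def by measurable
  show D: "D \<in> L2"
  proof (rule L2_bounded[OF m])
    show "\<bar>D t\<bar> \<le> h * h powr (\<alpha> - 3) / G" for t
    proof (cases "t \<in> {0..y - h}")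
      case True
      then have "(y - t) powr (\<alpha> - 3) \<le> h powr (\<alpha> - 3)"
        using a h by (intro powr_mono2') auto
      then show ?thesis
        using True G h by (simp add: D_def G_def abs_mult divide_right_mono)
    qed (use G h in \<open>simp add: D_def\<close>)
  qed
  show "L2norm D \<le> 1 / Gamma (\<alpha> - 1) * h powr (\<alpha> - 3/2)"
  proof (cases "h \<le> y")
    case False
    then have "D = (\<lambda>t. 0)" by (auto simp: D_def)
    then show ?thesis using G by (simp add: L2norm_const G_def)
  next
    case True
    define F where "F t = (y - t) powr (2 * \<alpha> - 5) / (5 - 2 * \<alpha>)" for t
    have "L2ip D D = (\<integral>t. (h / G)\<^sup>2 * ((y - t) powr (2 * \<alpha> - 6) * indicator {0..y - h} t) \<partial>lborel)"
      unfolding L2ip_def set_lebesgue_integral_def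
    proof (rule Bochner_Integration.integral_cong[OF refl])
      fix t
      have "((y - t) powr (\<alpha> - 3))\<^sup>2 = (y - t) powr (2 * \<alpha> - 6)"
        by (simp add: power2_eq_square powr_add[symmetric])
      then show "indicator {0..1} t *\<^sub>R (D t * D t) = (h / G)\<^sup>2 * ((y - t) powr (2 * \<alpha> - 6) * indicator {0..y - h} t)"
        using y h by (auto simp: D_def G_def indicator_def power2_eq_square)
    qed
    also have "\<dots> = (h / G)\<^sup>2 * (F (y - h) - F 0)"
    proof -
      have "(\<integral>t. (y - t) powr (2 * \<alpha> - 6) * indicator {0..y - h} t \<partial>lborel) = F (y - h) - F 0"
      proof (rule integral_FTC_Icc_real)
        show "0 \<le> y - h" using True by simp
        fix t assume t: "0 \<le> t" "t \<le> y - h"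
        then have p: "0 < y - t" using h by simp
        have "(F has_real_derivative (2 * \<alpha> - 5) * (y - t) powr (2 * \<alpha> - 5 - 1) * (- 1) / (5 - 2 * \<alpha>)) (at t)"
          unfolding F_def[abs_def] using p a by (auto intro!: derivative_eq_intros)
        also have "(2 * \<alpha> - 5) * (y - t) powr (2 * \<alpha> - 5 - 1) * (- 1) / (5 - 2 * \<alpha>) = (y - t) powr (2 * \<alpha> - 6)"
          using a by (simp add: field_simps)
        finally show "(F has_real_derivative (y - t) powr (2 * \<alpha> - 6)) (at t)" .
        show "isCont (\<lambda>t. (y - t) powr (2 * \<alpha> - 6)) t"
          using p by (intro continuous_intros) auto
      qed
      then show ?thesis by simp
    qed
    also have "\<dots> \<le> (h / G)\<^sup>2 * h powr (2 * \<alpha> - 5)"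
    proof (rule mult_left_mono)
      have "h powr (2 * \<alpha> - 5) / (5 - 2 * \<alpha>) \<le> h powr (2 * \<alpha> - 5) / 1"
        using a by (intro divide_left_mono) auto
      then have "F (y - h) \<le> h powr (2 * \<alpha> - 5)" by (simp add: F_def)
      moreover have "0 \<le> F 0" using a by (simp add: F_def)
      ultimately show "F (y - h) - F 0 \<le> h powr (2 * \<alpha> - 5)" by simp
    qed simp
    also have "\<dots> = (1 / G * h powr (\<alpha> - 3/2))\<^sup>2"
    proof -
      have "h\<^sup>2 * h powr (2 * \<alpha> - 5) = (h powr (\<alpha> - 3/2))\<^sup>2"
        using h by (simp add: power2_eq_square powr_add[symmetric] powr_numeral[symmetric] powr_mult_base algebra_simps)
      then show ?thesis by (simp add: power_mult_distrib power_divide)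
    qed
    finally have "(L2norm D)\<^sup>2 \<le> (1 / G * h powr (\<alpha> - 3/2))\<^sup>2" by (simp add: L2norm_square)
    then show ?thesis
      unfolding G_def[symmetric] by (rule power2_le_imp_le) (use G in simp)
  qed
qed

text \<open>Mean value theorem: the factor \<open>2 - \<alpha>\<close> is at most 1, and the power
  with the negative exponent \<open>\<alpha> - 3\<close> is largest at the end \<open>t\<close>
  nearest to the singularity.\<close>

lemma kap_increment:
  assumes a: "3/2 < \<alpha>" "\<alpha> < 2" and t: "s \<le> t" "t < y"
  shows "\<bar>kap \<alpha> y t - kap \<alpha> y s\<bar> \<le> (t - s) * (y - t) powr (\<alpha> - 3) / Gamma (\<alpha> - 1)"
proof (cases "s = t")
  case False
  define G where "G = Gamma (\<alpha> - 1)"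
  have G: "0 < G" using a by (auto simp: G_def intro!: Gamma_real_pos)
  have "\<exists>z. s < z \<and> z < t \<and> (y - t) powr (\<alpha> - 2) - (y - s) powr (\<alpha> - 2) =
      (t - s) * ((\<alpha> - 2) * (y - z) powr (\<alpha> - 2 - 1) * (- 1))"
  proof (rule MVT2)
    show "s < t" using t False by simp
    show "((\<lambda>z. (y - z) powr (\<alpha> - 2)) has_real_derivative (\<alpha> - 2) * (y - z) powr (\<alpha> - 2 - 1) * (- 1)) (at z)"
      if "s \<le> z" "z \<le> t" for z
      using that t by (auto intro!: derivative_eq_intros)
  qed
  then obtain z where z: "s < z" "z < t"
    and e: "(y - t) powr (\<alpha> - 2) - (y - s) powr (\<alpha> - 2) = (t - s) * ((2 - \<alpha>) * (y - z) powr (\<alpha> - 3))"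
    by (auto simp: algebra_simps)
  have "(2 - \<alpha>) * (y - z) powr (\<alpha> - 3) \<le> 1 * (y - t) powr (\<alpha> - 3)"
    using a z t by (intro mult_mono powr_mono2') auto
  moreover have "0 \<le> (2 - \<alpha>) * (y - z) powr (\<alpha> - 3)" using a by simp
  ultimately have "\<bar>(y - t) powr (\<alpha> - 2) - (y - s) powr (\<alpha> - 2)\<bar> \<le> (t - s) * (y - t) powr (\<alpha> - 3)"
    unfolding e using t by (simp add: abs_mult mult_left_mono)
  then have "\<bar>(y - t) powr (\<alpha> - 2) - (y - s) powr (\<alpha> - 2)\<bar> / G \<le> (t - s) * (y - t) powr (\<alpha> - 3) / G"
    using G by (intro divide_right_mono) auto
  then show ?thesis
    using t G by (simp add: kap_def G_def[symmetric] diff_divide_distrib[symmetric])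
qed simp

context partition
begin

text \<open>The approximant vanishes within distance \<open>2h\<close> of the singularity and interpolates elsewhere; both errors
  have the order \<open>h powr (\<alpha> - 3/2)\<close>.\<close>

lemma approx_kap:
  assumes a: "3/2 < \<alpha>" "\<alpha> < 2" and y: "y \<in> {0..1}"
  obtains P where "\<And>i. degree (P i) = 0"
    "L2norm (\<lambda>t. kap \<alpha> y t - pwp P t) \<le> ck3 \<alpha> * h powr (\<alpha> - 3/2)"
proof -
  \<comment> \<open>Cells have length at most \<open>h\<close>, so one that starts no later than
    \<open>y - 2 * h\<close> keeps distance \<open>h\<close> from the singularity, where sampling at
    the left node is accurate.\<close>
  define P where "P i = [:if x i \<le> y - 2 * h then kap \<alpha> y (x i) else 0:]" for i
  define c where "c = max 0 (y - 2 * h)"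
  define D1 where "D1 = (\<lambda>t. indicator {0..y - h} t * (h * (y - t) powr (\<alpha> - 3) / Gamma (\<alpha> - 1)))"
  define D2 where "D2 = (\<lambda>t. indicator {c..y} t * kap \<alpha> y t)"
  have c: "c \<in> {0..y}" using y mesh_pos by (auto simp: c_def)
  have G: "0 < Gamma (\<alpha> - 1)" using a by (auto intro!: Gamma_real_pos)
  note D1 = kap_smooth_part_norm[OF a _ mesh_pos, of y, folded D1_def]
  have y1: "y \<le> 1" using y by simp
  have D2: "D2 \<in> L2" unfolding D2_def by (rule kap_tail_L2[OF a(1) y c])
  have D1p: "0 \<le> D1 t" for t using G mesh_pos by (simp add: D1_def)
  have D2p: "0 \<le> D2 t" for t using a by (simp add: D2_def kap_nonneg)
  have "\<bar>kap \<alpha> y t - pwp P t\<bar> \<le> D1 t + D2 t" if t: "t \<in> {0..1}" for t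
  proof -
    define i where "i = idx t"
    note i = idx_props[OF t, folded i_def]
    have st: "t - x i \<le> h" using i(2) step_le_mesh[OF i(1)] by simp
    show ?thesis
    proof (cases "x i \<le> y - 2 * h")
      case True
      then have ty: "t \<le> y - h" using st by simp
      have "\<bar>kap \<alpha> y t - pwp P t\<bar> = \<bar>kap \<alpha> y t - kap \<alpha> y (x i)\<bar>"
        using True by (simp add: pwp_def P_def i_def[symmetric])
      also have "\<dots> \<le> (t - x i) * (y - t) powr (\<alpha> - 3) / Gamma (\<alpha> - 1)"
        using ty mesh_pos i by (intro kap_increment a) auto
      also have "\<dots> \<le> h * (y - t) powr (\<alpha> - 3) / Gamma (\<alpha> - 1)"
        using st G by (intro divide_right_mono mult_right_mono) auto
      also have "\<dots> = D1 t" using t ty by (simp add: D1_def)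
      finally show ?thesis using D2p[of t] by simp
    next
      case False
      have "kap \<alpha> y t = D2 t"
      proof (cases "t \<le> y")
        case True
        then show ?thesis using False i t by (simp add: D2_def c_def)
      qed (simp add: D2_def kap_def)
      then show ?thesis using False D1p[of t] D2p[of t] by (simp add: pwp_def P_def i_def[symmetric])
    qed
  qed
  then have "\<bar>kap \<alpha> y t - pwp P t\<bar> \<le> \<bar>D1 t + D2 t\<bar>" if "t \<in> {0..1}" for t
    using that by fastforce
  then have "L2norm (\<lambda>t. kap \<alpha> y t - pwp P t) \<le> L2norm (\<lambda>t. D1 t + D2 t)"
    by (rule L2norm_mono[OF L2_add[OF D1(1)[OF y1] D2] L2_measurable[OF L2_diff[OF kap_L2[OF a(1) y] pwp_L2]]])
  also have "\<dots> \<le> L2norm D1 + L2norm D2" by (rule L2norm_triangle[OF D1(1)[OF y1] D2])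
  also have "L2norm D1 \<le> 1 / Gamma (\<alpha> - 1) * h powr (\<alpha> - 3/2)" by (rule D1(2)[OF y1])
  also have "L2norm D2 \<le> 2 * ck \<alpha> * h powr (\<alpha> - 3/2)"
  proof -
    have "L2norm D2 = (y - c) powr (\<alpha> - 3/2) * ck \<alpha>"
      unfolding D2_def kap_tail_norm[OF a(1) y c] ck_def by simp
    also have "\<dots> \<le> (2 * h) powr (\<alpha> - 3/2) * ck \<alpha>"
      using a y c mesh_pos by (intro mult_right_mono powr_mono2 ck_nonneg) (auto simp: c_def)
    also have "(2 * h) powr (\<alpha> - 3/2) = 2 powr (\<alpha> - 3/2) * h powr (\<alpha> - 3/2)"
      using mesh_pos by (simp add: powr_mult)
    also have "2 powr (\<alpha> - 3/2) \<le> 2 powr 1"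
      using a by (intro powr_mono) auto
    finally show ?thesis
      using ck_nonneg[OF a(1)] by (simp add: mult_right_mono mult_ac)
  qed
  finally have "L2norm (\<lambda>t. kap \<alpha> y t - pwp P t) \<le> ck3 \<alpha> * h powr (\<alpha> - 3/2)"
    by (simp add: ck3_def algebra_simps)
  then show thesis by (intro that[of P]) (simp add: P_def)
qed

lemma Rop_orthogonal:
  assumes a: "3/2 < \<alpha>" "\<alpha> < 2" and y: "y \<in> {0..1}" and r: "r \<in> L2"
    and o: "\<And>P. (\<And>i. degree (P i) = 0) \<Longrightarrow> L2ip r (pwp P) = 0"
  shows "\<bar>Rop \<alpha> r y\<bar> \<le> ck3 \<alpha> * h powr (\<alpha> - 3/2) * L2norm r"
proof -
  obtain P where P: "\<And>i. degree (P i) = 0"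
    "L2norm (\<lambda>t. kap \<alpha> y t - pwp P t) \<le> ck3 \<alpha> * h powr (\<alpha> - 3/2)"
    using approx_kap[OF a y] by blast
  note K = kap_L2[OF a(1) y]
  have "Rop \<alpha> r y = L2ip (\<lambda>t. kap \<alpha> y t - pwp P t) r"
    using o[OF P(1)] by (simp add: L2ip_diff_left[OF K pwp_L2 r] Rop_def L2ip_commute[of r])
  also have "\<bar>\<dots>\<bar> \<le> L2norm (\<lambda>t. kap \<alpha> y t - pwp P t) * L2norm r"
    by (rule L2_Cauchy_Schwarz[OF L2_diff[OF K pwp_L2] r])
  also have "\<dots> \<le> ck3 \<alpha> * h powr (\<alpha> - 3/2) * L2norm r"
    by (rule mult_right_mono[OF P(2) L2norm_nonneg])
  finally show ?thesis .
qed

text \<open>The indicator of \<open>{0..x i}\<close> is piecewise constant, so \<open>prim r\<close>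
  vanishes at every node; only a part of one cell remains to be crossed.\<close>

lemma prim_orthogonal:
  assumes r: "r \<in> L2" and o: "\<And>P. (\<And>i. degree (P i) = 0) \<Longrightarrow> L2ip r (pwp P) = 0"
    and y: "y \<in> {0..1}"
  shows "\<bar>prim r y\<bar> \<le> sqrt h * L2norm r"
proof -
  define i where "i = idx y"
  note i = idx_props[OF y, folded i_def]
  have "prim r (x i) = 0"
  proof (cases "i = 0")
    case True
    then show ?thesis by (simp add: x_0 prim_0)
  next
    case False
    define P :: "nat \<Rightarrow> real poly" where "P j = [:if j < i then 1 else 0:]" for j
    have "pwp P t = indicator {0..x i} t" if t: "t \<in> {0..1}" for t
    proof -
      \<comment> \<open>Since nodes belong to the cell on their left, \<open>pwp P\<close> equals
        the indicator of the closed interval at every point.\<close>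
      have "idx t < i \<longleftrightarrow> t \<le> x i"
      proof
        assume "idx t < i"
        then have "x (Suc (idx t)) \<le> x i" using i by (intro x_mono) auto
        then show "t \<le> x i" using idx_upper[OF t] by simp
      next
        assume "t \<le> x i"
        then have "t \<le> x (Suc (i - 1))" using False by simp
        then have "idx t \<le> i - 1" unfolding idx_def by (rule Least_le)
        then show "idx t < i" using False by simp
      qed
      then show ?thesis using t by (simp add: pwp_def P_def indicator_def)
    qed
    then have "prim r (x i) = L2ip (pwp P) r"
      unfolding prim_def by (intro L2ip_cong) simp_all
    also have "\<dots> = 0" using o[of P] by (simp add: P_def L2ip_commute)
    finally show ?thesis .
  qed
  then have "\<bar>prim r y\<bar> \<le> sqrt \<bar>y - x i\<bar> * L2norm r"
    using prim_diff_sqrt[OF r y, of "x i"] x_in[of i] i by simp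
  also have "\<dots> \<le> sqrt h * L2norm r"
    using i step_le_mesh[OF i(1)] by (intro mult_right_mono) auto
  finally show ?thesis .
qed

end

section \<open>The Galerkin error\<close>

context fractional_problem
begin

text \<open>\<open>ck3\<close> bounds the fractional integral of \<open>r\<close>,
  \<open>2 * cqp\<close> leads from there to \<open>T r\<close>, and \<open>Cst\<close> from
  \<open>T r\<close> to \<open>T d\<close>.\<close>

definition Cgal :: real where
  "Cgal = Cst * (2 * cqp * ck3 \<alpha>)"

text \<open>Chosen to give \<open>CN * (1 + Cgal) * h \<le> 1 / 2\<close>, which makes the error
  term in \<open>rho1\<close> absorbable; the \<open>+ 1\<close> keeps the denominator
  positive.\<close>

definition mesh0 :: real where
  "mesh0 = 1 / (2 * (CN * (1 + Cgal) + 1))"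

lemma Cgal_nonneg: "0 \<le> Cgal"
  unfolding Cgal_def
  by (intro mult_nonneg_nonneg Cst_nonneg cqp_nonneg ck3_nonneg[OF alpha(1)]) simp

lemma mesh0_denominator_pos: "0 < CN * (1 + Cgal) + 1"
  using CN_nonneg Cgal_nonneg by (simp add: add_nonneg_pos)

lemma mesh0_pos: "0 < mesh0"
  using mesh0_denominator_pos by (simp add: mesh0_def)

text \<open>With \<open>d = (w - wh)'\<close>, Galerkin orthogonality says that \<open>r = d - T d\<close> is orthogonal to all piecewise
  polynomials of degree at most \<open>k\<close>. Hence \<open>T r\<close> is small, and stability applied to
  \<open>T d - T (T d) = T r\<close> shows that \<open>T d\<close> is of higher order than \<open>r\<close>.\<close>

lemma galerkin_error:
  assumes part: "is_partition n x" and hh: "mesh n x \<le> mesh0"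
    and w: "w \<in> H10" and wh: "wh \<in> FE_space k n x"
    and gal: "\<And>vh. vh \<in> FE_space k n x \<Longrightarrow> Aform \<alpha> q p w vh = Aform \<alpha> q p wh vh"
    and u: "u \<in> L2" "AE t in UI. wd w t = u t" and Pu: "\<And>i. degree (Pu i) \<le> k"
  shows "L2norm (wd (\<lambda>y. w y - wh y)) \<le> 2 * (1 + Cgal) * L2norm (\<lambda>t. u t - partition.pwp x Pu t)"
    and "L2norm (\<lambda>y. w y - wh y) \<le>
      mesh n x powr (\<alpha> - 3/2) * (2 * (1 + Cgal) * L2norm (\<lambda>t. u t - partition.pwp x Pu t))"
proof -
  note pos = mesh0_denominator_pos
  interpret partition n x by (unfold_locales) (rule part)
  \<comment> \<open>The order gained. As \<open>0 < s < 1/2\<close> and \<open>h \<le> 1\<close>,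
    the power \<open>h powr s\<close> is at most 1 and dominates \<open>sqrt h\<close>.\<close>
  define s where "s = \<alpha> - 3/2"
  have hs: "0 < h powr s" "h powr s \<le> 1" "sqrt h \<le> h powr s"
  proof -
    show "0 < h powr s" using mesh_pos by simp
    show "h powr s \<le> 1" using mesh_pos mesh_le_1 alpha by (intro powr_le1) (auto simp: s_def)
    have "h powr (1/2) \<le> h powr s" using mesh_pos mesh_le_1 alpha by (intro powr_mono') (auto simp: s_def)
    then show "sqrt h \<le> h powr s" using mesh_pos by (simp add: powr_half_sqrt)
  qed
  have wh10: "wh \<in> H10" by (rule FE_H10[OF wh])
  note W = wd_L2[OF H10_imp_H1[OF w]] and WH = wd_L2[OF H10_imp_H1[OF wh10]]
  define e where "e y = w y - wh y" for y
  have e: "e \<in> H10" "AE t in UI. wd e t = wd w t - wd wh t"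
    using H10_diff[OF w wh10] by (auto simp: e_def[abs_def])
  define d where "d = wd e"
  have d: "d \<in> L2" unfolding d_def by (rule wd_L2[OF H10_imp_H1[OF e(1)]])
  note Td = T_L2[OF d]
  define r where "r t = d t - T d t" for t
  have r: "r \<in> L2" unfolding r_def[abs_def] by (rule L2_diff[OF d Td])
  have rmean: "L2ip r (\<lambda>x. 1) = 0"
    using H10_mean_zero[OF e(1)] T_mean[OF d] unfolding r_def[abs_def] L2ip_diff_left[OF d Td L2_const]
    by (simp add: L2ip_commute[of _ "\<lambda>x. 1"] prim_1_L2ip d_def)
  have orth: "L2ip r (pwp P) = 0" if P: "\<And>i. degree (P i) \<le> k" for P
  proof -
    \<comment> \<open>Only mean-zero piecewise polynomials are derivatives of test functions, so the
      mean is split off; the constant is harmless because \<open>r\<close> has mean zero.\<close>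
    define c where "c = prim (pwp P) 1"
    define Q where "Q i = P i - [:c:]" for i
    have Qd: "degree (Q i) \<le> k" for i
      using degree_diff_le[of "P i" k "[:c:]"] P[of i] by (simp add: Q_def)
    have PQ: "pwp P = (\<lambda>t. pwp Q t + c)" by (auto simp: pwp_def Q_def)
    have "prim (\<lambda>t. c) 1 = c" by (simp add: prim_1)
    then have "prim (pwp Q) 1 = 0"
      using prim_add[OF pwp_L2 L2_const, of Q c 1, folded PQ] by (simp add: c_def[symmetric])
    then have F: "prim (pwp Q) \<in> FE_space k n x" by (rule prim_pwp_FE[OF Qd])
    define \<phi> where "\<phi> = prim (pwp Q)"
    have phi: "\<phi> \<in> H10" unfolding \<phi>_def by (rule FE_H10[OF F])
    note V = wd_L2[OF H10_imp_H1[OF phi]]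
    have "Aform \<alpha> q p w \<phi> = Aform \<alpha> q p wh \<phi>" using gal F by (simp add: \<phi>_def)
    then have "L2ip (\<lambda>x. wd w x - T (wd w) x) (wd \<phi>) - L2ip (\<lambda>x. wd wh x - T (wd wh) x) (wd \<phi>) = 0"
      by (simp add: Aform_eq[OF w phi] Aform_eq[OF wh10 phi])
    then have "L2ip (\<lambda>x. (wd w x - T (wd w) x) - (wd wh x - T (wd wh) x)) (wd \<phi>) = 0"
      by (simp only: L2ip_diff_left[OF L2_diff[OF W T_L2[OF W]] L2_diff[OF WH T_L2[OF WH]] V])
    also have "L2ip (\<lambda>x. (wd w x - T (wd w) x) - (wd wh x - T (wd wh) x)) (wd \<phi>) = L2ip r (wd \<phi>)"
    proof (rule L2ip_cong_AE[OF L2_diff[OF L2_diff[OF W T_L2[OF W]] L2_diff[OF WH T_L2[OF WH]]] r V])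
      have "T d = T (\<lambda>x. wd w x - wd wh x)"
        by (rule T_cong_AE[OF d L2_diff[OF W WH] e(2)[folded d_def]])
      then have "T d t = T (wd w) t - T (wd wh) t" for t
        using T_diff[OF W WH] by simp
      then show "AE t in UI. (wd w t - T (wd w) t) - (wd wh t - T (wd wh) t) = r t"
        using e(2) by (auto elim!: eventually_mono simp: r_def d_def)
    qed
    also have "L2ip r (wd \<phi>) = L2ip r (pwp Q)"
      using L2ip_cong_AE[OF V pwp_L2 r wd_prim[OF pwp_L2, of Q, folded \<phi>_def]]
      by (simp add: L2ip_commute[of r])
    finally have "L2ip r (pwp Q) = 0" .
    moreover have "L2ip r (pwp P) = L2ip r (pwp Q) + L2ip r (\<lambda>t. c)"
      unfolding PQ by (rule L2ip_add_right[OF pwp_L2 L2_const r])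
    moreover have "L2ip r (\<lambda>t. c) = 0"
      using L2ip_cmult_right[of r c "\<lambda>t. 1"] rmean by simp
    ultimately show ?thesis by simp
  qed
  have orth0: "L2ip r (pwp P) = 0" if "\<And>i. degree (P i) = 0" for P
    by (rule orth) (simp add: that)
  define \<rho> where "\<rho> = L2norm r"
  define \<eta> where "\<eta> = L2norm (\<lambda>t. u t - pwp Pu t)"
  have rho0: "0 \<le> \<rho>" by (simp add: \<rho>_def)
  have rho1: "\<rho> \<le> \<eta> + CN * L2norm d * h"
  proof -
    obtain P2 where P2: "\<And>i. degree (P2 i) = 0" "L2norm (\<lambda>t. T d t - pwp P2 t) \<le> CN * L2norm d * h"
      using approx_Lipschitz[OF mult_nonneg_nonneg[OF CN_nonneg L2norm_nonneg] T_Lipschitz[OF d] Td]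
      by blast
    obtain Pw where Pw: "\<And>i. degree (Pw i) \<le> k" "H1_rep wh (pwp Pw)"
      using FE_derivative[OF wh] by blast
    \<comment> \<open>\<open>Q\<close> collects all piecewise polynomial parts of \<open>r\<close>.
      It is orthogonal to \<open>r\<close> and drops out when \<open>r\<close> is tested with
      itself, which leaves the two approximation errors \<open>a\<close> and
      \<open>b\<close>.\<close>
    define Q where "Q i = Pu i - Pw i - P2 i" for i
    have Qd: "degree (Q i) \<le> k" for i
      unfolding Q_def using Pu Pw(1) P2(1) by (intro degree_diff_le) simp_all
    define a where "a t = u t - pwp Pu t" for t
    define b where "b t = T d t - pwp P2 t" for t
    have a: "a \<in> L2" unfolding a_def[abs_def] by (rule L2_diff[OF u(1) pwp_L2])
    have b: "b \<in> L2" unfolding b_def[abs_def] by (rule L2_diff[OF Td pwp_L2])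
    note ab = L2_diff[OF a b]
    have "AE t in UI. r t = (a t - b t) + pwp Q t"
      using e(2) u(2) wd_AE[OF Pw(2)]
      by eventually_elim (simp add: r_def a_def b_def d_def Q_def pwp_def)
    from L2ip_cong_AE[OF r L2_add[OF ab pwp_L2] r this]
    have "\<rho>\<^sup>2 = L2ip (\<lambda>t. a t - b t) r + L2ip (pwp Q) r"
      unfolding \<rho>_def L2norm_square L2ip_add_left[OF ab pwp_L2 r] .
    also have "\<dots> \<le> L2norm (\<lambda>t. a t - b t) * \<rho>"
      using L2_Cauchy_Schwarz[OF ab r] orth[OF Qd] by (simp add: \<rho>_def L2ip_commute[of _ r])
    finally have "\<rho> \<le> L2norm (\<lambda>t. a t - b t)"
      using rho0 by (cases "\<rho> = 0") (auto simp: power2_eq_square)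
    also have "\<dots> \<le> L2norm a + L2norm b" by (rule L2norm_triangle_diff[OF a b])
    also have "\<dots> \<le> \<eta> + CN * L2norm d * h"
      using P2(2) unfolding \<eta>_def a_def[abs_def] b_def[abs_def] by simp
    finally show ?thesis .
  qed
  have E: "\<bar>T d t\<bar> \<le> Cgal * h powr s * \<rho>" if t: "t \<in> {0..1}" for t
  proof -
    have "\<bar>T d t\<bar> \<le> Cst * (2 * cqp * (ck3 \<alpha> * h powr s * \<rho>))"
    proof (rule stability_bound[OF T_continuous[OF d] T_mean[OF d] _ t])
      fix t :: real assume t: "t \<in> {0..1}"
      have "T d t - T (T d) t = T r t"
        unfolding r_def[abs_def] by (rule T_diff[OF d Td, symmetric])
      then show "\<bar>T d t - T (T d) t\<bar> \<le> 2 * cqp * (ck3 \<alpha> * h powr s * \<rho>)"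
        using T_bound_of_R_bound[OF r t Rop_orthogonal[OF alpha _ r orth0]]
        by (simp add: s_def \<rho>_def)
    qed
    then show ?thesis by (simp add: Cgal_def mult_ac)
  qed
  have En: "L2norm (T d) \<le> Cgal * h powr s * \<rho>"
    by (rule L2norm_bounded[OF L2_measurable[OF Td] E])
  have dn: "L2norm d \<le> (1 + Cgal) * \<rho>"
  proof -
    have "L2norm d = L2norm (\<lambda>t. r t + T d t)" by (simp add: r_def)
    also have "\<dots> \<le> \<rho> + Cgal * h powr s * \<rho>"
      using L2norm_triangle[OF r Td] En by (simp add: \<rho>_def)
    also have "Cgal * h powr s * \<rho> \<le> Cgal * 1 * \<rho>"
      using hs Cgal_nonneg rho0 by (intro mult_right_mono mult_left_mono) auto
    finally show ?thesis by (simp add: algebra_simps)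
  qed
  \<comment> \<open>On meshes below \<open>mesh0\<close> the term with \<open>L2norm d\<close> is at
    most \<open>\<rho> / 2\<close> and moves to the left-hand side.\<close>
  have rho2: "\<rho> \<le> 2 * \<eta>"
  proof -
    have "CN * L2norm d * h \<le> CN * ((1 + Cgal) * \<rho>) * h"
      using dn CN_nonneg mesh_pos by (intro mult_right_mono mult_left_mono) auto
    also have "\<dots> = (CN * (1 + Cgal) * h) * \<rho>" by simp
    also have "\<dots> \<le> (1 / 2) * \<rho>"
    proof (rule mult_right_mono[OF _ rho0])
      have "CN * (1 + Cgal) * h \<le> (CN * (1 + Cgal) + 1) * h"
        using mesh_pos by (intro mult_right_mono) auto
      also have "\<dots> \<le> (CN * (1 + Cgal) + 1) * mesh0"
        using hh pos by (intro mult_left_mono) auto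
      also have "\<dots> = 1 / 2" using pos by (simp add: mesh0_def field_simps)
      finally show "CN * (1 + Cgal) * h \<le> 1 / 2" .
    qed
    finally show ?thesis using rho1 by simp
  qed
  have fin: "(1 + Cgal) * \<rho> \<le> 2 * (1 + Cgal) * \<eta>"
  proof -
    have "(1 + Cgal) * \<rho> \<le> (1 + Cgal) * (2 * \<eta>)"
      using rho2 Cgal_nonneg by (intro mult_left_mono) auto
    then show ?thesis by (simp only: mult_ac)
  qed
  \<comment> \<open>The two parts are small for different reasons: \<open>prim r\<close> vanishes at
    the nodes, which gives \<open>sqrt h\<close>, while \<open>T d\<close> is already small before
    it is integrated.\<close>
  have eb: "\<bar>e t\<bar> \<le> h powr s * (2 * (1 + Cgal) * \<eta>)" if t: "t \<in> {0..1}" for t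
  proof -
    have "e t = prim (\<lambda>t. r t + T d t) t"
      using H10_eq_prim[OF e(1) t] by (simp add: r_def d_def[symmetric])
    also have "\<dots> = prim r t + prim (T d) t" by (rule prim_add[OF r Td])
    also have "\<bar>\<dots>\<bar> \<le> \<bar>prim r t\<bar> + \<bar>prim (T d) t\<bar>" by (rule abs_triangle_ineq)
    also have "\<bar>prim r t\<bar> \<le> sqrt h * \<rho>"
      unfolding \<rho>_def by (rule prim_orthogonal[OF r orth0 t])
    also have "sqrt h * \<rho> \<le> h powr s * \<rho>" using hs rho0 by (intro mult_right_mono)
    also have "\<bar>prim (T d) t\<bar> \<le> Cgal * h powr s * \<rho>"
      using prim_bound[OF Td t] En by linarith
    also have "h powr s * \<rho> + Cgal * h powr s * \<rho> = h powr s * ((1 + Cgal) * \<rho>)"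
      by (simp add: algebra_simps)
    also have "\<dots> \<le> h powr s * (2 * (1 + Cgal) * \<eta>)"
      using fin hs by (intro mult_left_mono) auto
    finally show ?thesis by simp
  qed
  show "L2norm (wd (\<lambda>y. w y - wh y)) \<le> 2 * (1 + Cgal) * L2norm (\<lambda>t. u t - pwp Pu t)"
    using dn fin unfolding d_def e_def[abs_def] \<eta>_def by linarith
  show "L2norm (\<lambda>y. w y - wh y) \<le>
      mesh n x powr (\<alpha> - 3/2) * (2 * (1 + Cgal) * L2norm (\<lambda>t. u t - pwp Pu t))"
    using L2norm_bounded[OF L2_measurable[OF H1_L2[OF H10_imp_H1[OF e(1)]]] eb]
    unfolding e_def[abs_def] \<eta>_def s_def .
qed

text \<open>For \<open>k = 0\<close> the bound on \<open>H\<close> makes \<open>u\<close> Lipschitz,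
  which gives first order; for \<open>k = 1\<close> second order comes from the increments of
  \<open>H\<close>.\<close>

lemma approx_solution_derivative:
  assumes k: "k \<in> {0, 1}" and f: "f \<in> H1" and w: "w \<in> H10"
    and sol: "\<And>\<phi>. \<phi> \<in> H10 \<Longrightarrow> Aform \<alpha> q p w \<phi> = L2ip f \<phi>" and part: "is_partition n x"
  obtains u P where "u \<in> L2" "AE t in UI. wd w t = u t" "\<And>i. degree (P i) \<le> k"
    "L2norm (\<lambda>t. u t - partition.pwp x P t) \<le> Creg * mesh n x ^ (k + 1) * H1norm f"
proof -
  interpret partition n x by unfold_locales (rule part)
  obtain u H G where u: "u \<in> L2" and H: "H \<in> L2" and G: "G \<in> L2" and ae: "AE t in UI. wd w t = u t"
    and uH: "\<And>t. t \<in> {0..1} \<Longrightarrow> u t = u 0 + prim H t"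
    and Hb: "\<And>t. t \<in> {0..1} \<Longrightarrow> \<bar>H t\<bar> \<le> Creg * H1norm f"
    and Gn: "L2norm G \<le> Creg * H1norm f"
    and inc: "\<And>z y. 0 \<le> z \<Longrightarrow> z \<le> y \<Longrightarrow> y \<le> 1 \<Longrightarrow> \<bar>H y - H z\<bar> \<le> L2ip (indicator {z..y}) G"
    by (rule regularity[OF f w sol], assumption) (rule that)
  show thesis
  proof (cases "k = 0")
    case True
    have F: "0 \<le> Creg * H1norm f" using Hb[of 0] by simp
    have lip: "\<bar>u s - u t\<bar> \<le> Creg * H1norm f * \<bar>s - t\<bar>" if "s \<in> {0..1}" "t \<in> {0..1}" for s t
      using prim_diff_bound[OF H that Hb] uH[OF that(1)] uH[OF that(2)] by linarith
    obtain P where "\<And>i. degree (P i) = 0" "L2norm (\<lambda>t. u t - pwp P t) \<le> Creg * H1norm f * h"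
      by (rule approx_Lipschitz[OF F lip u], assumption+) (rule that)
    then show ?thesis using True by (intro that[OF u ae, of P]) (simp_all add: mult_ac)
  next
    case False
    then have k1: "k = 1" using k by simp
    obtain P where P: "\<And>i. degree (P i) \<le> 1" "L2norm (\<lambda>t. u t - pwp P t) \<le> h\<^sup>2 * L2norm G"
      by (rule approx_linear[OF H G uH u inc], assumption+) (rule that)
    have "h\<^sup>2 * L2norm G \<le> h\<^sup>2 * (Creg * H1norm f)" using Gn by (intro mult_left_mono) auto
    also have "\<dots> = Creg * h ^ (k + 1) * H1norm f" by (simp add: k1 power2_eq_square)
    finally show ?thesis using P k1 by (intro that[OF u ae, of P]) auto
  qed
qed

end

theorem theorem4p3:
  fixes \<alpha> \<rho> :: real and q p :: "real \<Rightarrow> real" and k :: nat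
  assumes "3/2 < \<alpha>" and "\<alpha> < 2"
    and "q \<in> H1" and "p \<in> H1"
    and "k \<in> {0, 1}"
    and "\<rho> > 0"
    and "\<forall>w\<in>H10. (\<forall>v\<in>H10. Aform \<alpha> q p w v = 0) \<longrightarrow> (\<forall>y\<in>{0..1}. w y = 0)"
    and "\<forall>v\<in>H10. (\<forall>w\<in>H10. Aform \<alpha> q p w v = 0) \<longrightarrow> (\<forall>y\<in>{0..1}. v y = 0)"
  shows "\<exists>h0>0. \<forall>\<beta>. 2 - \<alpha> < \<beta> \<and> \<beta> < 1/2 \<longrightarrow>
    (\<exists>C. \<forall>f w n x wh.
        f \<in> H1 \<and> w \<in> H10 \<and> (\<forall>\<phi>\<in>H10. Aform \<alpha> q p w \<phi> = L2ip f \<phi>)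
      \<and> is_partition n x \<and> quasi_uniform \<rho> n x \<and> mesh n x \<le> h0
      \<and> wh \<in> FE_space k n x \<and> (\<forall>vh\<in>FE_space k n x. Aform \<alpha> q p wh vh = L2ip f vh)
      \<longrightarrow> L2norm (\<lambda>y. w y - wh y) + mesh n x powr (\<alpha> - 2 + \<beta>) * L2norm (wd (\<lambda>y. w y - wh y))
          \<le> C * mesh n x powr (\<alpha> + real k - 1 + \<beta>) * H1norm f)"
proof -
  interpret fractional_problem \<alpha> q p
    by unfold_locales (use assms in blast)+
  show ?thesis
  proof (rule exI[of _ mesh0], rule conjI[OF mesh0_pos], intro allI impI)
    fix \<beta> assume \<beta>: "2 - \<alpha> < \<beta> \<and> \<beta> < 1/2"
    show "\<exists>C. \<forall>f w n x wh.
        f \<in> H1 \<and> w \<in> H10 \<and> (\<forall>\<phi>\<in>H10. Aform \<alpha> q p w \<phi> = L2ip f \<phi>)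
      \<and> is_partition n x \<and> quasi_uniform \<rho> n x \<and> mesh n x \<le> mesh0
      \<and> wh \<in> FE_space k n x \<and> (\<forall>vh\<in>FE_space k n x. Aform \<alpha> q p wh vh = L2ip f vh)
      \<longrightarrow> L2norm (\<lambda>y. w y - wh y) + mesh n x powr (\<alpha> - 2 + \<beta>) * L2norm (wd (\<lambda>y. w y - wh y))
          \<le> C * mesh n x powr (\<alpha> + real k - 1 + \<beta>) * H1norm f"
    \<comment> \<open>One factor 2 comes from the absorption in \<open>galerkin_error\<close>, the
      other from adding the two norms; \<beta> does not enter.\<close>
    proof (intro exI[of _ "4 * (1 + Cgal) * Creg"] allI impI)
      fix f w n x wh
      assume A: "f \<in> H1 \<and> w \<in> H10 \<and> (\<forall>\<phi>\<in>H10. Aform \<alpha> q p w \<phi> = L2ip f \<phi>)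
      \<and> is_partition n x \<and> quasi_uniform \<rho> n x \<and> mesh n x \<le> mesh0
      \<and> wh \<in> FE_space k n x \<and> (\<forall>vh\<in>FE_space k n x. Aform \<alpha> q p wh vh = L2ip f vh)"
      then have f: "f \<in> H1" and w: "w \<in> H10" and sol: "\<forall>\<phi>\<in>H10. Aform \<alpha> q p w \<phi> = L2ip f \<phi>"
        and part: "is_partition n x" and hh: "mesh n x \<le> mesh0" and wh: "wh \<in> FE_space k n x"
        and dis: "\<forall>vh\<in>FE_space k n x. Aform \<alpha> q p wh vh = L2ip f vh"
        by blast+
      interpret partition n x by unfold_locales (rule part)
      have orth: "Aform \<alpha> q p w vh = Aform \<alpha> q p wh vh" if "vh \<in> FE_space k n x" for vh
        using sol dis FE_H10[OF that] that by simp
      obtain u P where u: "u \<in> L2" "AE t in UI. wd w t = u t" and P: "\<And>i. degree (P i) \<le> k"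
        and \<eta>: "L2norm (\<lambda>t. u t - pwp P t) \<le> Creg * h ^ (k + 1) * H1norm f"
        by (rule approx_solution_derivative[OF assms(5) f w sol[rule_format] part], assumption) (rule that)
      define \<gamma> where "\<gamma> = 2 * (1 + Cgal) * (Creg * h ^ (k + 1) * H1norm f)"
      define z where "z = 2 * (1 + Cgal) * L2norm (\<lambda>t. u t - pwp P t)"
      have z: "z \<le> \<gamma>" "0 \<le> z"
        using mult_left_mono[OF \<eta>, of "2 * (1 + Cgal)"] Cgal_nonneg by (simp_all add: z_def \<gamma>_def)
      have est: "L2norm (wd (\<lambda>y. w y - wh y)) \<le> z" "L2norm (\<lambda>y. w y - wh y) \<le> h powr (\<alpha> - 3/2) * z"
        unfolding z_def
        by (rule galerkin_error[where Pu = P, OF part hh w wh orth u P], assumption)+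
      define s where "s = h powr (\<alpha> - 2 + \<beta>)"
      \<comment> \<open>As \<open>h \<le> 1\<close>, the smaller exponent
        \<open>\<alpha> - 2 + \<beta>\<close> gives the larger power, so the same factor
        \<open>s\<close> serves for both norms.\<close>
      have s: "0 \<le> s" "h powr (\<alpha> - 3/2) \<le> s"
        using mesh_pos mesh_le_1 \<beta> unfolding s_def by (auto intro!: powr_mono')
      have "L2norm (\<lambda>y. w y - wh y) \<le> s * \<gamma>"
        using est mult_mono[OF s(2) z(1) s(1) z(2)] by linarith
      moreover have "s * L2norm (wd (\<lambda>y. w y - wh y)) \<le> s * \<gamma>"
        using est z by (intro mult_left_mono s) linarith
      moreover have "s * h ^ (k + 1) = h powr (\<alpha> + real k - 1 + \<beta>)"
        using mesh_pos unfolding s_def powr_realpow[OF mesh_pos, symmetric] powr_add[symmetric]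
        by (simp add: algebra_simps)
      moreover have "2 * (s * \<gamma>) = 4 * (1 + Cgal) * Creg * (s * h ^ (k + 1)) * H1norm f"
        by (simp add: \<gamma>_def algebra_simps)
      ultimately show "L2norm (\<lambda>y. w y - wh y) + mesh n x powr (\<alpha> - 2 + \<beta>) * L2norm (wd (\<lambda>y. w y - wh y))
          \<le> 4 * (1 + Cgal) * Creg * mesh n x powr (\<alpha> + real k - 1 + \<beta>) * H1norm f"
        unfolding s_def by simp
    qed
  qed
qed

end
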